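(* Let $\Delta\geq D\geq 1$ be integers. The wide diameter of $\Gamma_\Delta(D)$ is at most $D+2$, and it is exactly $D+2$ if $D\geq 4$. Specifically, if $X$ and $Y$ are distinct vertices of $\Gamma_\Delta(D)$, then there is a bijection $\theta$ from $N(X)\setminus\{Y\}$ to $M(Y)\setminus\{X\}$ such that the shortest directed paths from $Z$ to $\theta(Z)$, for $Z\in N(X)\setminus\{Y\}$, are pairwise vertex disjoint and none of them contains $X$ or $Y$.
   Context: For integers $\Delta\geq D\ge 1$, the cycle prefix digraph $\Gamma_\Delta(D)$ is defined as follows. Its vertices are the sequences $x_1x_2\cdots x_D$ of $D$ distinct letters from the alphabet $\{1,2,\ldots,\Delta+1\}$. There is an arc from $x_1x_2\cdots x_D$ to each of the following vertices, and to no others: (rotations) $x_k x_1\cdots x_{k-1}x_{k+1}\cdots x_D$ for each $k$ with $2\leq k\leq D$; (shifts) $y x_1x_2\cdots x_{D-1}$ for each $y\in\{1,\ldots,\Delta+1\}\setminus\{x_1,\ldots,x_D\}$. In $\Gamma_\Delta(D)$ the shortest directed path between any two given vertices is known to be unique (it is the one-vertex path when the two vertices coincide). $N(X)$ denotes the set of vertices $Z$ such that $(X,Z)$ is an arc, and $M(Y)$ denotes the set of vertices $Z$ such that $(Z,Y)$ is an arc. Wide diameter: let $G$ be a digraph of (vertex) connectivity $k$. For distinct vertices $x,y$ of $G$, a container from $x$ to $y$ is a set of $k$ directed paths from $x$ to $y$ that are pairwise vertex-disjoint apart from their common endpoints $x$ and $y$ (such a set exists by Menger's theorem). The length of a container is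 the maximum length of a path in it. The wide distance from $x$ to $y$ is the minimum length of a container from $x$ to $y$, and the wide diameter of $G$ is the maximum wide distance over all ordered pairs of distinct vertices. (The digraph $\Gamma_\Delta(D)$ is known to have connectivity equal to its degree $\Delta$.) *)

theory Defs
  imports
    "Graph_Theory.Graph_Theory"
    "HOL-Library.Extended_Nat"
    "HOL-Library.Disjoint_Sets"
begin

text \<open>
  Digraphs have no parallel arcs here (\<^typ>\<open>'a pair_pre_digraph\<close>), so directed paths are
  vertex lists (\<^const>\<open>vpath\<close>). A path from a vertex to itself is the one-vertex list, of length 0.
\<close>

definition out_nbrs :: "'a pair_pre_digraph \<Rightarrow> 'a \<Rightarrow> 'a set" where
  "out_nbrs G x = {z. x \<rightarrow>\<^bsub>with_proj G\<^esub> z}"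

definition in_nbrs :: "'a pair_pre_digraph \<Rightarrow> 'a \<Rightarrow> 'a set" where
  "in_nbrs G y = {z. z \<rightarrow>\<^bsub>with_proj G\<^esub> y}"

definition path_from_to :: "'a pair_pre_digraph \<Rightarrow> 'a \<Rightarrow> 'a list \<Rightarrow> 'a \<Rightarrow> bool" where
  "path_from_to G x p y \<longleftrightarrow> vpath p (with_proj G) \<and> hd p = x \<and> last p = y"

definition is_shortest_path :: "'a pair_pre_digraph \<Rightarrow> 'a \<Rightarrow> 'a list \<Rightarrow> 'a \<Rightarrow> bool" where
  "is_shortest_path G x p y \<longleftrightarrow>
     path_from_to G x p y \<and> (\<forall>q. path_from_to G x q y \<longrightarrow> vwalk_length p \<le> vwalk_length q)"

text \<open>Only meaningful where the shortest path is unique, as it always is in a cycle prefix digraph.\<close>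

definition shortest_path :: "'a pair_pre_digraph \<Rightarrow> 'a \<Rightarrow> 'a \<Rightarrow> 'a list" where
  "shortest_path G x y = (THE p. is_shortest_path G x p y)"

text \<open>
  The least number of vertices whose removal leaves a digraph that is not strongly connected or
  has at most one vertex; the second alternative gives the complete digraph on \<open>n\<close> vertices
  connectivity \<open>n - 1\<close>.
\<close>

definition vertex_connectivity :: "'a pair_pre_digraph \<Rightarrow> nat" where
  "vertex_connectivity G =
     (LEAST k. \<exists>S \<subseteq> pverts G. card S = k \<and>
        (\<not> strongly_connected (with_proj G \<restriction> (pverts G - S)) \<or> card (pverts G - S) \<le> 1))"

definition containers :: "'a pair_pre_digraph \<Rightarrow> 'a \<Rightarrow> 'a \<Rightarrow> 'a list set set" where
  "containers G x y =
     {C. finite C \<and> card C = vertex_connectivity G \<and>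
         (\<forall>p \<in> C. path_from_to G x p y) \<and>
         (\<forall>p \<in> C. \<forall>q \<in> C. p \<noteq> q \<longrightarrow> set p \<inter> set q = {x, y})}"

text \<open>
  Lengths take values in \<^typ>\<open>enat\<close>, so that a pair of vertices without a container would have
  wide distance \<open>\<infinity>\<close>.
\<close>

definition container_length :: "'a list set \<Rightarrow> enat" where
  "container_length C = (SUP p \<in> C. enat (vwalk_length p))"

definition wide_distance :: "'a pair_pre_digraph \<Rightarrow> 'a \<Rightarrow> 'a \<Rightarrow> enat" where
  "wide_distance G x y = (INF C \<in> containers G x y. container_length C)"

definition wide_diameter :: "'a pair_pre_digraph \<Rightarrow> enat" where
  "wide_diameter G =
     (SUP (x, y) \<in> {(x, y). x \<in> pverts G \<and> y \<in> pverts G \<and> x \<noteq> y}. wide_distance G x y)"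

definition cp_verts :: "nat \<Rightarrow> nat \<Rightarrow> nat list set" where
  "cp_verts \<Delta> D = {xs. length xs = D \<and> distinct xs \<and> set xs \<subseteq> {1..\<Delta> + 1}}"

text \<open>
  List positions count from 0: the letter \<open>x\<^sub>k\<close> is \<open>xs ! (k - 1)\<close>, with
  \<open>x\<^sub>1\<cdots>x\<^sub>k\<^sub>-\<^sub>1\<close> before it and \<open>x\<^sub>k\<^sub>+\<^sub>1\<cdots>x\<^sub>D\<close> after it.
\<close>

definition rotations :: "nat list \<Rightarrow> nat list set" where
  "rotations xs = {xs ! (k - 1) # take (k - 1) xs @ drop k xs | k. 2 \<le> k \<and> k \<le> length xs}"

definition shifts :: "nat \<Rightarrow> nat list \<Rightarrow> nat list set" where
  "shifts \<Delta> xs = {y # butlast xs | y. y \<in> {1..\<Delta> + 1} - set xs}"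

definition cycle_prefix_digraph :: "nat \<Rightarrow> nat \<Rightarrow> nat list pair_pre_digraph" where
  "cycle_prefix_digraph \<Delta> D =
     \<lparr>pverts = cp_verts \<Delta> D,
      parcs = {(xs, ys). xs \<in> cp_verts \<Delta> D \<and> ys \<in> rotations xs \<union> shifts \<Delta> xs}\<rparr>"

end

theory Submission
  imports Defs "HOL-Library.Sublist"
begin

text \<open>
  An arc of the cycle prefix digraph moves a letter \<open>a\<close>, other than the first one, to the front
  (dropping the last letter if \<open>a\<close> is new). So walks are words of letters, and a word without
  repetitions describes a shortest path as soon as some unused letter stands before its first moved
  letter; shortest paths are therefore unique.

  Relabel so that \<open>Y = 1 2 \<cdots> D\<close>, let \<open>x\<close> be the first letter of \<open>X\<close> and \<open>m\<close> the distance from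
  \<open>X\<close> to \<open>Y\<close>. The out-neighbours of \<open>X\<close> are indexed by the letter \<open>a \<noteq> x\<close> that was moved, and from each
  of them an explicit word leads to an in-neighbour of \<open>Y\<close>. Generically this word is \<open>2 \<cdots> D\<close> for
  \<open>a\<close> outside \<open>2 \<cdots> D\<close>, and \<open>2 \<cdots> a 1 (a+1) \<cdots> m\<close> for \<open>2 \<le> a < m\<close>; the other words depend on whether
  \<open>x \<notin> {2..D}\<close>, \<open>x < m\<close> or \<open>x = m + 1\<close> (nothing else is possible). The paths are disjoint because
  \<open>a\<close> can be read off every vertex \<open>V\<close> on its path, essentially from the first place where \<open>V\<close>
  stops counting upwards by one. Disjointness makes the end vertices distinct, and
  counting makes the map to them a bijection.

  For the lower bound take \<open>X = (D+1) 2 \<cdots> D\<close>: in every out-neighbour of \<open>X\<close> but one the letter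
  \<open>D + 1\<close> stands before \<open>D\<close>, so that \<open>D\<close> moves are needed to reach the in-neighbours
  \<open>2 1 3 \<cdots> D\<close> and \<open>2 3 1 4 \<cdots> D\<close> of \<open>Y\<close>; a container uses both of them.
\<close>

section \<open>Moving letters to the front\<close>

text \<open>The \<open>take\<close> covers both kinds of arcs. For a letter of a distinct
  \<open>X\<close> nothing is cut off and the move is a rotation; a new letter pushes out the last
  one, which is a shift.\<close>

definition mtf :: "'a \<Rightarrow> 'a list \<Rightarrow> 'a list" where
  "mtf a X = take (length X) (a # filter (\<lambda>b. b \<noteq> a) X)"

text \<open>For a word \<open>s\<close> without repetitions this is the vertex reached from
  \<open>X\<close> by moving the letters of \<open>s\<close> to the front, the last letter of
  \<open>s\<close> first.\<close>

definition pull :: "'a list \<Rightarrow> 'a list \<Rightarrow> 'a list" where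
  "pull s X = take (length X) (s @ filter (\<lambda>b. b \<notin> set s) X)"

lemma filter_neq_id: "a \<notin> set w \<Longrightarrow> filter (\<lambda>b. b \<noteq> a) w = w"
  by (induction w) auto

lemma length_filter_notin:
  "distinct X \<Longrightarrow> length X \<le> length (filter (\<lambda>b. b \<notin> set s) X) + length s"
proof -
  assume d: "distinct X"
  have "length X = length (filter (\<lambda>b. b \<notin> set s) X) + length (filter (\<lambda>b. \<not> b \<notin> set s) X)"
    by (rule sum_length_filter_compl[symmetric])
  moreover have "length (filter (\<lambda>b. \<not> b \<notin> set s) X) = card (set (filter (\<lambda>b. \<not> b \<notin> set s) X))"
    using d by (simp add: distinct_card[symmetric])
  moreover have "\<dots> \<le> card (set s)" by (rule card_mono) auto
  ultimately show ?thesis using card_length[of s] by linarith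
qed

lemma length_mtf [simp]: "distinct X \<Longrightarrow> X \<noteq> [] \<Longrightarrow> length (mtf a X) = length X"
  using length_filter_notin[of X "[a]"] by (simp add: mtf_def)

lemma length_pull [simp]: "distinct X \<Longrightarrow> length (pull s X) = length X"
  using length_filter_notin[of X s] by (simp add: pull_def)

lemma hd_mtf [simp]: "X \<noteq> [] \<Longrightarrow> hd (mtf a X) = a"
  by (cases X) (auto simp: mtf_def)

lemma distinct_mtf [simp]: "distinct X \<Longrightarrow> distinct (mtf a X)"
  unfolding mtf_def by (rule distinct_take) auto

lemma set_mtf: "set (mtf a X) \<subseteq> insert a (set X)"
  unfolding mtf_def by (rule subset_trans[OF set_take_subset]) auto

lemma mtf_neq_Nil [simp]: "X \<noteq> [] \<Longrightarrow> mtf a X \<noteq> []"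
  by (cases X) (auto simp: mtf_def)

text \<open>A distinct list loses at most one letter to the filter, so \<open>n + 1\<close> letters
  before filtering determine \<open>n\<close> letters after it.\<close>

lemma take_filter_neq_take:
  "distinct L \<Longrightarrow> take n (filter (\<lambda>b. b \<noteq> a) (take (Suc n) L)) = take n (filter (\<lambda>b. b \<noteq> a) L)"
proof (induction L arbitrary: n)
  case (Cons b L)
  show ?case
  proof (cases "b = a")
    case True
    then have *: "filter (\<lambda>b. b \<noteq> a) L = L" "filter (\<lambda>b. b \<noteq> a) (take n L) = take n L"
      using Cons.prems by (auto simp: filter_id_conv dest: in_set_takeD)
    show ?thesis using True * by simp
  next
    case False
    then show ?thesis using Cons by (cases n) auto
  qed
qed simp

text \<open>Truncation can wait until after the move: the new front letter makes up for the one
  letter that the filter may remove.\<close>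

lemma mtf_take:
  assumes "distinct L" "n \<le> length L"
  shows "mtf a (take n L) = take n (a # filter (\<lambda>b. b \<noteq> a) L)"
proof (cases n)
  case (Suc k)
  then show ?thesis using assms take_filter_neq_take[of L k a] by (simp add: mtf_def min_absorb2)
qed (simp add: mtf_def)

lemma mtfs_pull:
  assumes "distinct X" "X \<noteq> []" "distinct w"
  shows "foldr mtf w X = pull w X"
  using assms(3)
proof (induction w)
  case Nil
  then show ?case by (simp add: pull_def)
next
  case (Cons a w)
  have "mtf a (pull w X) = take (length X) (a # filter (\<lambda>b. b \<noteq> a) (w @ filter (\<lambda>b. b \<notin> set w) X))"
    unfolding pull_def using Cons.prems assms length_filter_notin[OF assms(1), of w]
    by (intro mtf_take) auto
  also have "\<dots> = pull (a # w) X"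
    using Cons.prems by (simp add: pull_def filter_neq_id conj_commute)
  finally show ?case using Cons by simp
qed

lemma mtf_pull:
  assumes "distinct X" "distinct w"
  shows "mtf a (pull w X) = take (length X) (a # filter (\<lambda>b. b \<noteq> a) w @ filter (\<lambda>b. b \<notin> insert a (set w)) X)"
proof -
  have "mtf a (pull w X) = take (length X) (a # filter (\<lambda>b. b \<noteq> a) (w @ filter (\<lambda>b. b \<notin> set w) X))"
    unfolding pull_def using assms length_filter_notin[OF assms(1), of w]
    by (intro mtf_take) auto
  then show ?thesis by (simp add: conj_commute)
qed

text \<open>A first move of \<open>a\<close> is forgotten once \<open>a\<close> is moved again: the
  later move decides its place, and the set of moved letters stays the same.\<close>

lemma pull_mtf_absorb:
  assumes "distinct X" "X \<noteq> []" "distinct s" "a \<in> set s"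
  shows "foldr mtf s (mtf a X) = pull s X"
proof -
  have "foldr mtf s (mtf a X) = foldr mtf s X" using assms(3,4)
  proof (induction s)
    case (Cons b s)
    show ?case
    proof (cases "a \<in> set s")
      case True
      then show ?thesis using Cons by simp
    next
      case False
      then have ba: "b = a" using Cons.prems by auto
      have ds: "distinct (s @ [a])" "distinct s" using Cons.prems ba False by auto
      \<comment> \<open>The later move of \<open>a\<close> comes last. With or without the first
        one, the result is \<open>a\<close>, then \<open>s\<close>, then the unmoved letters of
        \<open>X\<close>.\<close>
      have "foldr mtf s (mtf a X) = pull (s @ [a]) X"
        using mtfs_pull[OF assms(1,2) ds(1)] by simp
      moreover have "foldr mtf s X = pull s X" by (rule mtfs_pull[OF assms(1,2) ds(2)])
      ultimately show ?thesis
        using ba False ds by (auto simp: mtf_pull assms(1) filter_id_conv intro!: arg_cong[where f="take _"] filter_cong)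
    qed
  qed simp
  then show ?thesis using mtfs_pull[OF assms(1-3)] by simp
qed

lemma pull_mtf:
  assumes "distinct X" "X \<noteq> []" "distinct (s @ [a])"
  shows "foldr mtf s (mtf a X) = pull (s @ [a]) X"
  using mtfs_pull[OF assms] by simp

text \<open>The letter \<open>b\<close> may be missing from \<open>X\<close>; it then counts as
  standing behind all letters of \<open>X\<close>.\<close>

definition prec :: "'a list \<Rightarrow> 'a \<Rightarrow> 'a \<Rightarrow> bool" where
  "prec X a b \<longleftrightarrow> a \<noteq> b \<and> (\<exists>p q. X = p @ a # q \<and> b \<notin> set p)"

lemma prec_Nil [simp]: "\<not> prec [] a b"
  by (simp add: prec_def)

lemma prec_Cons [simp]:
  "prec (c # X) a b \<longleftrightarrow> a \<noteq> b \<and> (c = a \<or> c \<noteq> b \<and> prec X a b)"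
proof
  assume "prec (c # X) a b"
  then obtain p q where "c # X = p @ a # q" "b \<notin> set p" "a \<noteq> b" by (auto simp: prec_def)
  then show "a \<noteq> b \<and> (c = a \<or> c \<noteq> b \<and> prec X a b)"
    by (cases p) (auto simp: prec_def)
next
  assume r: "a \<noteq> b \<and> (c = a \<or> c \<noteq> b \<and> prec X a b)"
  show "prec (c # X) a b"
  proof (cases "c = a")
    case True
    then show ?thesis using r unfolding prec_def by (metis append_Nil empty_iff empty_set)
  next
    case False
    then obtain p q where "X = p @ a # q" "b \<notin> set p" using r by (auto simp: prec_def)
    then have "c # X = (c # p) @ a # q" "b \<notin> set (c # p)" using r False by auto
    then show ?thesis using r unfolding prec_def by blast
  qed
qed

lemma prec_in_set: "prec X a b \<Longrightarrow> a \<in> set X"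
  by (auto simp: prec_def)

lemma prec_neq: "prec X a b \<Longrightarrow> a \<noteq> b"
  by (auto simp: prec_def)

lemma prec_append:
  "prec (X @ X') a b \<longleftrightarrow> prec X a b \<or> a \<noteq> b \<and> b \<notin> set X \<and> prec X' a b"
  by (induction X) (auto dest: prec_neq)

lemma prec_filter: "P a \<Longrightarrow> P b \<Longrightarrow> prec (filter P X) a b \<longleftrightarrow> prec X a b"
  by (induction X) (auto dest: prec_neq)

lemma prec_total: "a \<in> set X \<Longrightarrow> a \<noteq> b \<Longrightarrow> prec X a b \<or> prec X b a"
  by (induction X) auto

lemma prec_take: "prec X a b \<Longrightarrow> b \<in> set (take n X) \<Longrightarrow> prec (take n X) a b"
proof (induction X arbitrary: n)
  case (Cons c X)
  then show ?case by (cases n) auto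
qed simp

lemma prec_notin: "a \<in> set X \<Longrightarrow> b \<notin> set X \<Longrightarrow> prec X a b"
  by (induction X) auto

lemma prec_hd: "X \<noteq> [] \<Longrightarrow> hd X \<noteq> b \<Longrightarrow> prec X (hd X) b"
  by (cases X) auto

text \<open>The first break in counting upwards to \<open>D\<close>; 0 stands for a missing letter.\<close>

fun brk :: "nat \<Rightarrow> nat list \<Rightarrow> nat \<times> nat" where
  "brk D (a # b # L) = (if b = Suc a \<and> b \<le> D then brk D (b # L) else (a, b))"
| "brk D [a] = (a, 0)"
| "brk D [] = (0, 0)"

text \<open>\<open>brk\<close> never counts beyond \<open>D\<close>, so at \<open>l = D\<close> the
  run stops whatever \<open>z\<close> is.\<close>

lemma brk_upt:
  assumes "k \<le> l" "l \<le> D" "z \<noteq> Suc l \<or> l = D"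
  shows "brk D ([k..<Suc l] @ z # r) = (l, z)"
  using assms(1)
proof (induction k rule: inc_induct)
  case base
  then show ?case using assms by auto
next
  case (step k)
  have k: "[k..<Suc l] = k # [Suc k..<Suc l]"
    using step.hyps by (simp add: upt_conv_Cons del: upt_Suc)
  obtain M where M: "[Suc k..<Suc l] @ z # r = Suc k # M"
    using step.hyps by (cases "[Suc k..<Suc l]") (auto simp: upt_eq_Cons_conv simp del: upt_Suc)
  have "brk D ([k..<Suc l] @ z # r) = brk D (k # Suc k # M)"
    by (simp only: k append_Cons M)
  also have "\<dots> = brk D (Suc k # M)" using step.hyps assms by simp
  finally show ?case using step.IH M by simp
qed

text \<open>At most \<open>card B\<close> of the first \<open>n\<close> letters are rejected by
  \<open>P\<close>, so at least \<open>length p\<close> of them pass, and these begin with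
  \<open>p\<close>.\<close>

lemma prefix_filter_take:
  assumes "prefix p (filter P L)" "distinct L" "finite B" "\<And>a. a \<in> set L \<Longrightarrow> \<not> P a \<Longrightarrow> a \<in> B"
    and "length p + card B \<le> n" "n \<le> length L"
  shows "prefix p (filter P (take n L))"
proof -
  have "prefix (filter P (take n L)) (filter P L)"
    by (metis append_take_drop_id filter_append prefixI)
  moreover have "length p \<le> length (filter P (take n L))"
  proof -
    have "length (filter (\<lambda>a. \<not> P a) (take n L)) = card (set (filter (\<lambda>a. \<not> P a) (take n L)))"
      using assms(2) by (simp add: distinct_card[symmetric] del: set_filter)
    also have "\<dots> \<le> card B" using assms(3,4) by (intro card_mono) (auto dest: in_set_takeD)
    finally show ?thesis
      using sum_length_filter_compl[of P "take n L"] assms(5,6) by simp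
  qed
  ultimately show ?thesis using assms(1) prefix_length_prefix by blast
qed

lemma suffix_upt: "suffix s [k..<l] \<Longrightarrow> s \<noteq> [] \<Longrightarrow> \<exists>i. k \<le> i \<and> i < l \<and> s = [i..<l]"
proof -
  assume s: "suffix s [k..<l]" "s \<noteq> []"
  then obtain n where n: "s = drop n [k..<l]" by (metis suffix_def append_eq_conv_conj)
  then have "s = [k + n..<l]" by simp
  then show ?thesis using s(2) by (intro exI[of _ "k + n"]) auto
qed

lemma suffix_append_cases:
  assumes "suffix s (u @ v)"
  obtains "suffix s v" | t where "suffix t u" "t \<noteq> []" "s = t @ v"
proof (cases "suffix s v")
  case False
  then obtain t where "s = t @ v" "suffix t u" using assms by (auto simp: suffix_append)
  then show ?thesis using that(2) False by (cases "t = []") auto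
qed (rule that(1))

lemma filter_less_upt: "l \<le> n \<Longrightarrow> filter (\<lambda>a. n < a) [Suc l..<k] = [Suc n..<k]"
  by (induction k) (auto simp: not_less_eq_eq)

text \<open>The run may go on into \<open>r\<close>, so only a lower bound for its last letter is
  available.\<close>

lemma brk_ge:
  assumes "k \<le> l" "l \<le> D"
  shows "l \<le> fst (brk D ([k..<Suc l] @ r))"
proof -
  have *: "n \<le> fst (brk D (n # r))" for n
  proof (induction r arbitrary: n)
    case (Cons b r)
    show ?case using Cons[of b] by auto
  qed simp
  have "n \<le> l \<Longrightarrow> brk D ([n..<Suc l] @ r) = brk D (l # r)" for n
  proof (induction n rule: inc_induct)
    case (step n)
    have k: "[n..<Suc l] = n # [Suc n..<Suc l]"
      using step.hyps by (simp add: upt_conv_Cons del: upt_Suc)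
    obtain M where M: "[Suc n..<Suc l] @ r = Suc n # M"
      using step.hyps by (cases "[Suc n..<Suc l]") (auto simp: upt_eq_Cons_conv simp del: upt_Suc)
    have "brk D ([n..<Suc l] @ r) = brk D (n # Suc n # M)"
      by (simp only: k append_Cons M)
    also have "\<dots> = brk D (Suc n # M)" using step.hyps assms by simp
    finally show ?case using step.IH M by simp
  qed simp
  then show ?thesis using * assms by simp
qed

section \<open>Separated routes to the identity\<close>

lemma upt_append: "i \<le> j \<Longrightarrow> j \<le> k \<Longrightarrow> [i..<j] @ [j..<k] = [i..<k]"
  using upt_add_eq_append[of i j "k - j"] by simp

section \<open>Alignment with the target and the families of routes\<close>

locale cp_start =
  fixes D \<Delta> :: nat and X :: "nat list"
  assumes D: "1 \<le> D" "D \<le> \<Delta>"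
    and X: "length X = D" "distinct X" "set X \<subseteq> {1..\<Delta> + 1}" "X \<noteq> [1..<Suc D]"
begin

text \<open>For \<open>l \<le> D\<close> this says exactly that \<open>pull [1..<Suc l] X\<close> is
  the target; the least such \<open>l\<close> is therefore the distance from \<open>X\<close> to the
  target.\<close>

definition aligned :: "nat \<Rightarrow> bool" where
  "aligned l \<longleftrightarrow> prefix [Suc l..<Suc D] (filter (\<lambda>a. l < a) X)"

text \<open>The word \<open>w\<close> of a shortest path from \<open>mtf a X\<close> to an
  in-neighbour of the target. The letter \<open>z\<close> certifies that the path is shortest, the
  condition on \<open>hd\<close> makes the final move of 1 an arc, and the suffixes of
  \<open>w\<close> run through the vertices of the path, all of which get the label
  \<open>a\<close>.\<close>

definition route :: "nat \<Rightarrow> nat list \<Rightarrow> (nat list \<Rightarrow> nat) \<Rightarrow> bool" where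
  "route a w L \<longleftrightarrow> a \<in> {1..\<Delta> + 1} \<and> set w \<subseteq> {1..\<Delta> + 1} \<and> distinct w \<and> length w \<le> D \<and>
     (w = [] \<or> (\<exists>z. z \<notin> set w \<and> prec (mtf a X) z (last w))) \<and>
     hd (w @ [a]) \<noteq> 1 \<and> mtf 1 (foldr mtf w (mtf a X)) = [1..<Suc D] \<and>
     (\<forall>s. suffix s w \<longrightarrow> L (foldr mtf s (mtf a X)) = a)"

lemma X_ne [simp]: "X \<noteq> []"
  using D X(1) by auto

lemma X_pos: "a \<in> set X \<Longrightarrow> 1 \<le> a"
  using X(3) by auto

text \<open>After the move of 1 exactly the letters \<open>1\<close>, ..., \<open>l\<close> have
  been moved. The others are those above \<open>l\<close>, which alignment puts in the right
  order.\<close>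

lemma mtf_1_pull:
  assumes "distinct s" "filter (\<lambda>b. b \<noteq> 1) s = [2..<Suc l]" "aligned l" "1 \<le> l" "l \<le> D"
  shows "mtf 1 (pull s X) = [1..<Suc D]"
proof -
  have "insert 1 (set s) = insert 1 (set (filter (\<lambda>b. b \<noteq> 1) s))" by auto
  also have "\<dots> = {1..l}" using assms by (auto simp del: upt_Suc)
  finally have s: "insert 1 (set s) = {1..l}" .
  obtain q where q: "filter (\<lambda>a. l < a) X = [Suc l..<Suc D] @ q"
    using assms(3) unfolding aligned_def prefix_def by auto
  have "filter (\<lambda>b. b \<notin> insert 1 (set s)) X = filter (\<lambda>a. l < a) X"
    unfolding s using X_pos by (intro filter_cong) auto
  then have "mtf 1 (pull s X) = take D (1 # [2..<Suc l] @ [Suc l..<Suc D] @ q)"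
    using mtf_pull[OF X(2) assms(1), of 1] assms(2) q X(1) by simp
  also have "1 # [2..<Suc l] @ [Suc l..<Suc D] @ q = [1..<Suc D] @ q"
  proof -
    have "1 # [2..<Suc l] = [1..<Suc l]" using assms(4) by (simp add: upt_conv_Cons numeral_2_eq_2 del: upt_Suc)
    moreover have "[1..<Suc l] @ [Suc l..<Suc D] = [1..<Suc D]"
      using assms(4,5) by (intro upt_append) auto
    ultimately show ?thesis by (metis append_Cons append_assoc)
  qed
  finally show ?thesis by (simp del: upt_Suc)
qed

lemma mtf_1_pull_full:
  assumes "distinct s" "filter (\<lambda>b. b \<noteq> 1) s = [2..<Suc D] @ t"
  shows "mtf 1 (pull s X) = [1..<Suc D]"
proof -
  have "mtf 1 (pull s X) = take D (1 # ([2..<Suc D] @ t) @ filter (\<lambda>b. b \<notin> insert 1 (set s)) X)"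
    using mtf_pull[OF X(2) assms(1), of 1] assms(2) X(1) by simp
  also have "\<dots> = take D ([1..<Suc D] @ t @ filter (\<lambda>b. b \<notin> insert 1 (set s)) X)"
    using D by (simp add: upt_conv_Cons numeral_2_eq_2 del: upt_Suc)
  finally show ?thesis by (simp del: upt_Suc)
qed

text \<open>The witness may change: \<open>z\<close> can be pushed out together with \<open>c\<close>.\<close>

lemma ex_prec_mtf:
  assumes "z > l" "prec X z c" "a \<noteq> c" "1 \<le> a" "a \<le> l" "1 \<le> c" "c \<le> l" "l \<le> D"
  shows "\<exists>z>l. prec (mtf a X) z c"
proof (cases "c \<in> set (mtf a X)")
  case True
  have "prec (a # filter (\<lambda>b. b \<noteq> a) X) z c"
    using assms prec_filter[of "\<lambda>b. b \<noteq> a" z c X] by auto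
  then have "prec (mtf a X) z c" using True unfolding mtf_def by (intro prec_take)
  then show ?thesis using assms by auto
next
  case False
  \<comment> \<open>\<open>D\<close> distinct letters do not fit into \<open>l - 1\<close>
    places.\<close>
  have "\<not> set (mtf a X) \<subseteq> {1..l} - {c}"
  proof
    assume "set (mtf a X) \<subseteq> {1..l} - {c}"
    then have "card (set (mtf a X)) \<le> card ({1..l} - {c})" by (intro card_mono) auto
    also have "\<dots> = l - 1" using assms by simp
    finally show False using assms X by (simp add: distinct_card)
  qed
  then obtain z' where z': "z' \<in> set (mtf a X)" "z' \<notin> {1..l} - {c}" by blast
  have "1 \<le> z'" using z'(1) set_mtf[of a X] X_pos assms(4) by blast
  moreover have "z' \<noteq> c" using z'(1) False by auto
  ultimately have "z' > l" using z'(2) by auto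
  then show ?thesis using z' False prec_notin by metis
qed

text \<open>The path ends in \<open>2 .. D a\<close>, or, for \<open>a = 1\<close> and an aligned
  \<open>l\<close>, with 1 right behind \<open>l\<close>. The letter \<open>a\<close> heads
  \<open>mtf a X\<close> and lies outside the word, so it serves as the witness
  \<open>z\<close>.\<close>

lemma route_below:
  assumes a: "a \<in> {1..\<Delta> + 1}" "a \<notin> {2..l}" "l \<le> D" "l = D \<or> a = 1 \<and> aligned l" "a = 1 \<longrightarrow> 2 \<le> l"
    and L0: "L (mtf a X) = a"
    and L1: "\<And>k. 2 \<le> k \<Longrightarrow> k \<le> l \<Longrightarrow> L (pull ([k..<Suc l] @ [a]) X) = a"
  shows "route a [2..<Suc l] L"
proof -
  let ?w = "[2..<Suc l]"
  have w: "distinct (?w @ [a])" "distinct ?w" using a(2) by (auto simp del: upt_Suc)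
  have f: "foldr mtf ?w (mtf a X) = pull (?w @ [a]) X"
    by (rule pull_mtf[OF X(2) X_ne w(1)])
  have "mtf 1 (pull (?w @ [a]) X) = [1..<Suc D]"
  proof (cases "l = D")
    case True
    have "filter (\<lambda>b. b \<noteq> 1) (?w @ [a]) = [2..<Suc D] @ filter (\<lambda>b. b \<noteq> 1) [a]"
      using True by (simp add: filter_neq_id del: upt_Suc)
    then show ?thesis by (rule mtf_1_pull_full[OF w(1)])
  next
    case False
    then have "a = 1" "aligned l" using a(4) by auto
    then show ?thesis using a(3,5)
      by (intro mtf_1_pull[OF w(1)]) (auto simp: filter_neq_id simp del: upt_Suc)
  qed
  moreover have "?w = [] \<or> (\<exists>z. z \<notin> set ?w \<and> prec (mtf a X) z (last ?w))"
  proof (cases "?w = []")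
    case False
    then have "last ?w = l" "2 \<le> l" by (auto simp: last_upt split: if_splits)
    then have "prec (mtf a X) a (last ?w)" using prec_hd[of "mtf a X" l] a(2) by auto
    moreover have "a \<notin> set ?w" using a(2) by auto
    ultimately show ?thesis by blast
  qed simp
  moreover have "hd (?w @ [a]) \<noteq> 1"
  proof (cases "?w = []")
    case True
    then show ?thesis using a(5) by auto
  next
    case False
    then show ?thesis by (auto simp: hd_upt simp del: upt_Suc)
  qed
  moreover have "L (foldr mtf s (mtf a X)) = a" if s: "suffix s ?w" for s
  proof (cases "s = []")
    case False
    then obtain i where i: "2 \<le> i" "i < Suc l" "s = [i..<Suc l]" using suffix_upt[OF s] by auto
    then have "distinct (s @ [a])" using a(2) by (auto simp del: upt_Suc)
    then show ?thesis using L1[of i] i pull_mtf[OF X(2) X_ne, of s a] by simp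
  qed (use L0 in simp)
  ultimately show ?thesis
    unfolding route_def f using a D w by (auto simp del: upt_Suc)
qed

text \<open>The path ends in \<open>2 .. j 1 (j+1) .. D\<close>. The letter \<open>j\<close> is
  moved again after 1, which absorbs its first move. \<open>L1\<close>, \<open>L2\<close> and
  \<open>L3\<close> concern the vertices before, at and after the move of 1.\<close>

lemma route_split:
  assumes j: "2 \<le> j" "j \<le> l" "l \<le> D" "aligned l"
    and z: "z > l" "prec X z (if j = l then 1 else l)"
    and L0: "L (mtf j X) = j"
    and L1: "\<And>k. j < k \<Longrightarrow> k \<le> l \<Longrightarrow> L (pull ([k..<Suc l] @ [j]) X) = j"
    and L2: "L (pull (1 # [Suc j..<Suc l] @ [j]) X) = j"
    and L3: "\<And>k. 2 \<le> k \<Longrightarrow> k \<le> j \<Longrightarrow> L (pull ([k..<Suc j] @ 1 # [Suc j..<Suc l]) X) = j"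
  shows "route j ([2..<Suc j] @ 1 # [Suc j..<Suc l]) L"
proof -
  let ?w = "[2..<Suc j] @ 1 # [Suc j..<Suc l]"
  have w: "distinct ?w" "j \<in> set ?w" using j by (auto simp del: upt_Suc)
  have f: "foldr mtf ?w (mtf j X) = pull ?w X"
    by (rule pull_mtf_absorb[OF X(2) X_ne w])
  have ww: "[2..<Suc j] @ [Suc j..<Suc l] = [2..<Suc l]"
    using j by (intro upt_append) auto
  have "mtf 1 (pull ?w X) = [1..<Suc D]"
    using j ww by (intro mtf_1_pull[OF w(1)]) (auto simp: filter_neq_id simp del: upt_Suc)
  moreover have "\<exists>z. z \<notin> set ?w \<and> prec (mtf j X) z (last ?w)"
  proof -
    have "last ?w = (if j = l then 1 else l)" using j by (auto simp: last_upt simp del: upt_Suc)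
    moreover have "\<exists>z>l. prec (mtf j X) z (if j = l then 1 else l)"
      by (rule ex_prec_mtf[OF z]) (use j in auto)
    moreover have "z \<notin> set ?w" if "z > l" for z using that j by (auto simp del: upt_Suc)
    ultimately show ?thesis by metis
  qed
  moreover have "hd (?w @ [j]) \<noteq> 1" using j by (auto simp: hd_append hd_upt simp del: upt_Suc)
  moreover have "length ?w \<le> D" using j by (auto simp del: upt_Suc)
  moreover have "L (foldr mtf s (mtf j X)) = j" if s: "suffix s ?w" for s
    using s
  proof (cases rule: suffix_append_cases)
    case 1
    then consider "s = []" | "s = 1 # [Suc j..<Suc l]" | "s \<noteq> []" "suffix s [Suc j..<Suc l]"
      by (auto simp: suffix_Cons)
    then show ?thesis
    proof cases
      case 2
      then have "distinct (s @ [j])" using j by (auto simp del: upt_Suc)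
      then show ?thesis using 2 L2 pull_mtf[OF X(2) X_ne, of s j] by simp
    next
      case 3
      then obtain i where i: "Suc j \<le> i" "i < Suc l" "s = [i..<Suc l]" using suffix_upt by blast
      then have "distinct (s @ [j])" using j by (auto simp del: upt_Suc)
      then show ?thesis using i L1[of i] pull_mtf[OF X(2) X_ne, of s j] by simp
    qed (use L0 in simp)
  next
    case (2 t)
    then obtain i where i: "2 \<le> i" "i < Suc j" "t = [i..<Suc j]" using suffix_upt by blast
    then have "distinct s" "j \<in> set s" using 2 j by (auto simp del: upt_Suc)
    then show ?thesis using i 2 L3[of i] pull_mtf_absorb[OF X(2) X_ne, of s j] by simp
  qed
  ultimately show ?thesis
    unfolding route_def f using j D w by (auto simp del: upt_Suc)
qed

text \<open>The first move of \<open>j\<close> already supplies the end of the run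
  \<open>2 .. j\<close>; 1 is not moved, and its place is left to \<open>X\<close>.\<close>

lemma route_within:
  assumes j: "2 \<le> j" "j \<le> D" "aligned j"
    and L0: "L (mtf j X) = j"
    and L1: "\<And>k. 2 \<le> k \<Longrightarrow> k < j \<Longrightarrow> L (pull [k..<Suc j] X) = j"
  shows "route j [2..<j] L"
proof -
  let ?w = "[2..<j]"
  have f: "foldr mtf ?w (mtf j X) = pull [2..<Suc j] X"
    using pull_mtf[OF X(2) X_ne, of ?w j] j by simp
  have "mtf 1 (pull [2..<Suc j] X) = [1..<Suc D]"
    using j by (intro mtf_1_pull) (auto simp: filter_neq_id simp del: upt_Suc)
  moreover have "?w = [] \<or> (\<exists>z. z \<notin> set ?w \<and> prec (mtf j X) z (last ?w))"
  proof (cases "?w = []")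
    case False
    then have "last ?w \<noteq> j" by (metis atLeastLessThan_iff last_in_set less_irrefl set_upt)
    then have "prec (mtf j X) j (last ?w)" using prec_hd[of "mtf j X" "last ?w"] by auto
    then show ?thesis by auto
  qed simp
  moreover have "hd (?w @ [j]) \<noteq> 1" using j by (auto simp: hd_append hd_upt)
  moreover have "L (foldr mtf s (mtf j X)) = j" if s: "suffix s ?w" for s
  proof (cases "s = []")
    case False
    then obtain i where i: "2 \<le> i" "i < j" "s = [i..<j]" using suffix_upt[OF s] by auto
    then show ?thesis using L1[of i] i pull_mtf[OF X(2) X_ne, of s j] by simp
  qed (use L0 in simp)
  ultimately show ?thesis
    unfolding route_def f using j D by auto
qed

text \<open>As in \<open>route_within\<close> the first move of \<open>l\<close> is kept, but 1 is
  put behind an earlier letter \<open>q\<close>: the path ends where \<open>route_split\<close>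
  would lead from \<open>q\<close>.\<close>

lemma route_shifted:
  assumes j: "2 \<le> q" "q < l" "l \<le> D" "aligned l"
    and L0: "L (mtf l X) = l"
    and L1: "\<And>k. q < k \<Longrightarrow> k < l \<Longrightarrow> L (pull [k..<Suc l] X) = l"
    and L2: "L (pull (1 # [Suc q..<Suc l]) X) = l"
    and L3: "\<And>k. 2 \<le> k \<Longrightarrow> k \<le> q \<Longrightarrow> L (pull ([k..<Suc q] @ 1 # [Suc q..<Suc l]) X) = l"
  shows "route l ([2..<Suc q] @ 1 # [Suc q..<l]) L"
proof -
  let ?w = "[2..<Suc q] @ 1 # [Suc q..<l]"
  have up: "[i..<l] @ [l] = [i..<Suc l]" if "i \<le> l" for i using that by simp
  have w: "distinct (?w @ [l])" using j by (auto simp del: upt_Suc)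
  have wl: "?w @ [l] = [2..<Suc q] @ 1 # [Suc q..<Suc l]" using up[of "Suc q"] j by simp
  have f: "foldr mtf ?w (mtf l X) = pull ([2..<Suc q] @ 1 # [Suc q..<Suc l]) X"
    using pull_mtf[OF X(2) X_ne w] wl by simp
  have ww: "[2..<Suc q] @ [Suc q..<Suc l] = [2..<Suc l]"
    using j by (intro upt_append) auto
  have "mtf 1 (pull ([2..<Suc q] @ 1 # [Suc q..<Suc l]) X) = [1..<Suc D]"
    using j ww w wl by (intro mtf_1_pull) (auto simp: filter_neq_id simp del: upt_Suc)
  moreover have "\<exists>z. z \<notin> set ?w \<and> prec (mtf l X) z (last ?w)"
  proof -
    have "last ?w \<in> set ?w" by (rule last_in_set) simp
    moreover have l: "l \<notin> set ?w" using w by (simp del: upt_Suc)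
    ultimately have "last ?w \<noteq> l" by metis
    then have "prec (mtf l X) l (last ?w)" using prec_hd[of "mtf l X" "last ?w"] by simp
    then show ?thesis using l by blast
  qed
  moreover have "hd (?w @ [l]) \<noteq> 1" using j by (auto simp: hd_append hd_upt simp del: upt_Suc)
  moreover have "length ?w \<le> D" using j by (auto simp del: upt_Suc)
  moreover have "L (foldr mtf s (mtf l X)) = l" if s: "suffix s ?w" for s
    using s
  proof (cases rule: suffix_append_cases)
    case 1
    then consider "s = []" | "s = 1 # [Suc q..<l]" | "s \<noteq> []" "suffix s [Suc q..<l]"
      by (auto simp: suffix_Cons)
    then show ?thesis
    proof cases
      case 2
      then have "s @ [l] = 1 # [Suc q..<Suc l]" using up[of "Suc q"] j by simp
      moreover from this have "distinct (s @ [l])" using j by (auto simp del: upt_Suc)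
      ultimately show ?thesis using L2 pull_mtf[OF X(2) X_ne, of s l] by simp
    next
      case 3
      then obtain i where i: "Suc q \<le> i" "i < l" "s = [i..<l]" using suffix_upt by blast
      then have "s @ [l] = [i..<Suc l]" using up[of i] by simp
      moreover have "distinct (s @ [l])" using i by simp
      ultimately show ?thesis using L1[of i] i pull_mtf[OF X(2) X_ne, of s l] by simp
    qed (use L0 in simp)
  next
    case (2 t)
    then obtain i where i: "2 \<le> i" "i < Suc q" "t = [i..<Suc q]" using suffix_upt by blast
    have "s @ [l] = [i..<Suc q] @ 1 # [Suc q..<Suc l]" using 2 i j up[of "Suc q"] by simp
    moreover from this have "distinct (s @ [l])" using i j by (auto simp del: upt_Suc)
    ultimately show ?thesis using i L3[of i] pull_mtf[OF X(2) X_ne, of s l] by simp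
  qed
  ultimately show ?thesis
    unfolding route_def f using j D w by (auto simp del: upt_Suc)
qed

text \<open>Here \<open>a\<close> is pushed out again, so that the path ends in
  \<open>2 .. D 1\<close> instead of \<open>2 .. D a\<close>.\<close>

lemma route_outside:
  assumes a: "D < a" "a \<le> \<Delta> + 1" "2 \<le> D"
    and L0: "L (mtf a X) = a"
    and L1: "L (pull [1, a] X) = a"
    and L2: "\<And>k. 2 \<le> k \<Longrightarrow> k \<le> D \<Longrightarrow> L (pull ([k..<Suc D] @ [1, a]) X) = a"
  shows "route a ([2..<Suc D] @ [1]) L"
proof -
  let ?w = "[2..<Suc D] @ [1]"
  have w: "distinct (?w @ [a])" "distinct ?w" using a(1,3) by (auto simp del: upt_Suc)
  have f: "foldr mtf ?w (mtf a X) = pull (?w @ [a]) X"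
    by (rule pull_mtf[OF X(2) X_ne w(1)])
  have "mtf 1 (pull (?w @ [a]) X) = [1..<Suc D]"
  proof (rule mtf_1_pull_full[OF w(1)])
    show "filter (\<lambda>b. b \<noteq> 1) (?w @ [a]) = [2..<Suc D] @ [a]"
      using a by (simp add: filter_neq_id del: upt_Suc)
  qed
  moreover have "\<exists>z. z \<notin> set ?w \<and> prec (mtf a X) z (last ?w)"
    using prec_hd[of "mtf a X" "last ?w"] a by (intro exI[of _ a]) (auto simp del: upt_Suc)
  moreover have "hd (?w @ [a]) \<noteq> 1" using a by (auto simp: hd_append hd_upt simp del: upt_Suc)
  moreover have "length ?w \<le> D" using a by simp
  moreover have "L (foldr mtf s (mtf a X)) = a" if s: "suffix s ?w" for s
    using s
  proof (cases rule: suffix_append_cases)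
    case 1
    then have "s = [] \<or> s = [1]" by (auto simp: suffix_Cons)
    then show ?thesis using L0 L1 a pull_mtf[OF X(2) X_ne, of s a] by auto
  next
    case (2 t)
    then obtain i where i: "2 \<le> i" "i < Suc D" "t = [i..<Suc D]" using suffix_upt by blast
    have "distinct (s @ [a])" using 2 i a by (auto simp del: upt_Suc)
    then show ?thesis using 2 i L2[of i] pull_mtf[OF X(2) X_ne, of s a] by simp
  qed
  ultimately show ?thesis
    unfolding route_def f using a D w by (auto simp del: upt_Suc)
qed

section \<open>The first letter of the start and its distance to the target\<close>

definition x where "x = hd X"

definition m where "m = (LEAST l. aligned l)"

lemma X_eq: "X = x # tl X"
  unfolding x_def by simp

lemma x_in: "x \<in> set X"
  unfolding x_def by simp

lemma filter_X: "P x \<Longrightarrow> filter P X = x # filter P (tl X)"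
  by (subst X_eq) simp

lemma aligned_mono:
  assumes "aligned l" "l \<le> n"
  shows "aligned n"
proof -
  obtain q where q: "filter (\<lambda>a. l < a) X = [Suc l..<Suc D] @ q"
    using assms unfolding aligned_def prefix_def by auto
  have "filter (\<lambda>a. n < a) X = filter (\<lambda>a. n < a) (filter (\<lambda>a. l < a) X)"
    using assms(2) by (auto intro!: filter_cong)
  also have "\<dots> = [Suc n..<Suc D] @ filter (\<lambda>a. n < a) q"
    using q assms(2) by (simp add: filter_less_upt del: upt_Suc)
  finally show ?thesis unfolding aligned_def prefix_def by blast
qed

lemma aligned_D: "aligned D"
  by (simp add: aligned_def)

lemma not_aligned_0: "\<not> aligned 0"
proof
  assume "aligned 0"
  moreover have "filter (\<lambda>a. 0 < a) X = X" using X_pos by (intro filter_True) fastforce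
  ultimately obtain q where q: "X = [1..<Suc D] @ q"
    unfolding aligned_def prefix_def by (auto simp del: upt_Suc)
  moreover from this have "length X = length [1..<Suc D] + length q" by (metis length_append)
  ultimately show False using X(1,4) by (simp del: upt_Suc)
qed

lemma aligned_m: "aligned m"
  unfolding m_def using aligned_D by (rule LeastI)

lemma m_le: "m \<le> D"
  unfolding m_def using aligned_D by (rule Least_le)

lemma not_aligned: "l < m \<Longrightarrow> \<not> aligned l"
  unfolding m_def by (rule not_less_Least)

lemma m_ge: "1 \<le> m"
  using not_aligned_0 aligned_m by (cases m) auto

lemma aligned_ge: "m \<le> l \<Longrightarrow> aligned l"
  using aligned_mono aligned_m by blast

lemma aligned_in_set: "m \<le> l \<Longrightarrow> l < a \<Longrightarrow> a \<le> D \<Longrightarrow> a \<in> set X"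
proof -
  assume a: "m \<le> l" "l < a" "a \<le> D"
  have "set [Suc l..<Suc D] \<subseteq> set (filter (\<lambda>a. l < a) X)"
    using aligned_ge[OF a(1)] unfolding aligned_def by (rule set_mono_prefix)
  moreover have "a \<in> set [Suc l..<Suc D]" using a by (simp del: upt_Suc)
  ultimately show ?thesis by auto
qed

text \<open>Alignment at \<open>m\<close> prolongs the run from \<open>m\<close> to
  \<open>D\<close>. For \<open>j < m\<close> this contradicts the minimality of \<open>m\<close>,
  which is how the lemma is applied.\<close>

lemma filter_above_m_run:
  assumes "filter (\<lambda>a. j < a) X = [Suc j..<Suc m] @ q"
  shows "aligned j"
proof (cases "j \<le> m")
  case True
  have d: "distinct ([Suc j..<Suc m] @ q)" using X(2) assms by (metis distinct_filter)
  have q: "j < a" if "a \<in> set q" for a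
  proof -
    have "a \<in> set (filter (\<lambda>a. j < a) X)" using assms that by simp
    then show ?thesis by simp
  qed
  have "filter (\<lambda>a. m < a) X = filter (\<lambda>a. m < a) (filter (\<lambda>a. j < a) X)"
    using True by (auto intro!: filter_cong)
  also have "\<dots> = filter (\<lambda>a. m < a) q" using assms by simp
  also have "\<dots> = q"
  proof (rule filter_True, rule ballI)
    fix a assume a: "a \<in> set q"
    then have "a \<notin> set [Suc j..<Suc m]" using d unfolding distinct_append by blast
    then show "m < a" using q[OF a] by (simp del: upt_Suc)
  qed
  finally have "prefix [Suc m..<Suc D] q" using aligned_m unfolding aligned_def by simp
  then obtain r where "q = [Suc m..<Suc D] @ r" by (auto simp: prefix_def)
  then have "filter (\<lambda>a. j < a) X = ([Suc j..<Suc m] @ [Suc m..<Suc D]) @ r"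
    using assms by simp
  then show ?thesis using True m_le upt_append[of "Suc j" "Suc m" "Suc D"]
    unfolding aligned_def prefix_def by (simp del: upt_Suc)
qed (auto intro: aligned_ge)

text \<open>Otherwise \<open>m\<close> would come first among the letters from \<open>m\<close> on,
  and \<open>X\<close> would be aligned at \<open>m - 1\<close>. If \<open>m\<close> is missing, the
  \<open>D\<close> letters of \<open>X\<close> cannot all lie below it. The letter \<open>z\<close>
  is the witness for \<open>route_split\<close> with \<open>l = m\<close>.\<close>

lemma ex_prec_m: "\<exists>z>m. prec X z m"
proof (cases "m \<in> set X")
  case False
  have "\<not> set X \<subseteq> {1..m} - {m}"
  proof
    assume "set X \<subseteq> {1..m} - {m}"
    then have "card (set X) \<le> card ({1..m} - {m})" by (intro card_mono) auto
    then show False using m_ge m_le X by (simp add: distinct_card)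
  qed
  then obtain z where "z \<in> set X" "z \<notin> {1..m} - {m}" by blast
  then show ?thesis using False X_pos prec_notin[of z X m] by (intro exI[of _ z]) auto
next
  case True
  let ?F = "filter (\<lambda>a. m - 1 < a) X"
  have "m \<in> set ?F" using True m_ge by auto
  then obtain b r where F: "?F = b # r" by (metis list.exhaust empty_iff empty_set)
  have "b \<noteq> m"
  proof
    assume "b = m"
    then have "?F = [Suc (m - 1)..<Suc m] @ r" using F m_ge by simp
    then show False using filter_above_m_run not_aligned[of "m - 1"] m_ge by auto
  qed
  moreover have "b \<in> set ?F" using F by simp
  ultimately have "b > m" by auto
  moreover have "prec ?F b m" using F \<open>b \<noteq> m\<close> by simp
  then have "prec X b m" using \<open>b > m\<close> m_ge by (subst (asm) prec_filter) auto
  ultimately show ?thesis by blast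
qed

text \<open>\<open>x = m\<close> would give alignment at \<open>m - 1\<close>. If
  \<open>m < x \<le> D\<close>, then \<open>x\<close> is the first letter above \<open>m\<close> in
  \<open>X\<close>, which is \<open>m + 1\<close> by alignment.\<close>

lemma x_cases:
  obtains "x \<notin> {2..D}" | "2 \<le> x" "x < m" | "x = Suc m" "x \<le> D"
proof (cases "x \<in> {2..D} \<and> \<not> x < m")
  case True
  have "x \<noteq> m"
  proof
    assume "x = m"
    then have "filter (\<lambda>a. m - 1 < a) X = [Suc (m - 1)..<Suc m] @ filter (\<lambda>a. m - 1 < a) (tl X)"
      using m_ge by (simp add: filter_X)
    then show False using filter_above_m_run not_aligned[of "m - 1"] m_ge by auto
  qed
  then have xm: "m < x" using True by simp
  then have "filter (\<lambda>a. m < a) X = x # filter (\<lambda>a. m < a) (tl X)" by (simp add: filter_X)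
  moreover have "prefix [Suc m..<Suc D] (filter (\<lambda>a. m < a) X)"
    using aligned_m unfolding aligned_def .
  moreover have "[Suc m..<Suc D] = Suc m # [Suc (Suc m)..<Suc D]"
    using xm True by (auto simp: upt_conv_Cons simp del: upt_Suc)
  ultimately have "x = Suc m" by (metis prefix_Cons list.sel(1) prefix_Nil not_Cons_self2 Cons_prefix_Cons)
  then show ?thesis using that(3) True by simp
qed (use that in auto)

text \<open>Many vertices are told apart from \<open>X\<close> and its out-neighbours by being better aligned with
  the target than \<open>X\<close> is.\<close>

definition aligned_word :: "nat list \<Rightarrow> nat \<Rightarrow> bool" where
  "aligned_word V l \<longleftrightarrow> prefix [Suc l..<Suc D] (filter (\<lambda>a. l < a) V)"

lemma aligned_word_X: "aligned_word X l = aligned l"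
  by (simp add: aligned_def aligned_word_def)

text \<open>Moving a letter up to \<open>l\<close> keeps the order of the letters above
  \<open>l\<close> and can at most push one of them out.\<close>

lemma aligned_word_mtf:
  assumes "aligned_word (mtf h X) l" "h \<le> l"
  shows "aligned l"
proof -
  have "prefix (filter (\<lambda>a. l < a) (mtf h X)) (filter (\<lambda>a. l < a) (h # filter (\<lambda>b. b \<noteq> h) X))"
    unfolding mtf_def by (metis append_take_drop_id filter_append prefixI)
  also have "filter (\<lambda>a. l < a) (h # filter (\<lambda>b. b \<noteq> h) X) = filter (\<lambda>a. l < a) X"
    using assms(2) by (auto intro!: filter_cong)
  finally show ?thesis using assms(1) unfolding aligned_def aligned_word_def
    by (rule prefix_order.order_trans[rotated])
qed

lemma aligned_word_pull_aux:
  assumes "distinct s" "0 \<notin> set s" "l \<le> D"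
    and "prefix [Suc l..<Suc D] (filter (\<lambda>a. l < a) (s @ filter (\<lambda>b. b \<notin> set s) X))"
  shows "aligned_word (pull s X) l"
  unfolding aligned_word_def pull_def
\<comment> \<open>Only \<open>l\<close> letters are not above \<open>l\<close>, so cutting at
  \<open>D\<close> spares the \<open>D - l\<close> letters that matter.\<close>
proof (rule prefix_filter_take[where B = "{1..l}"])
  show "distinct (s @ filter (\<lambda>b. b \<notin> set s) X)" using assms(1) X(2) by auto
  show "a \<in> {1..l}" if "a \<in> set (s @ filter (\<lambda>b. b \<notin> set s) X)" "\<not> l < a" for a
    using that assms(2) X_pos by (cases "a = 0") auto
  show "length X \<le> length (s @ filter (\<lambda>b. b \<notin> set s) X)"
    using length_filter_notin[OF X(2), of s] by simp
qed (use assms X(1) in auto)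

text \<open>The moved letters supply \<open>l + 1\<close>, ..., \<open>n\<close>, and the alignment
  of \<open>X\<close> at \<open>n\<close> supplies the rest.\<close>

lemma aligned_word_pull:
  assumes "distinct s" "0 \<notin> set s" "filter (\<lambda>a. l < a) s = [Suc l..<Suc n]"
    and "l \<le> n" "n \<le> D" "aligned n"
  shows "aligned_word (pull s X) l"
proof (rule aligned_word_pull_aux)
  have "a \<in> set s \<longleftrightarrow> a \<le> n" if "l < a" for a
  proof -
    have "a \<in> set (filter (\<lambda>a. l < a) s) \<longleftrightarrow> a \<in> set [Suc l..<Suc n]" by (simp only: assms(3))
    then show ?thesis using that by (auto simp del: upt_Suc)
  qed
  then have "filter (\<lambda>a. l < a) (filter (\<lambda>b. b \<notin> set s) X) = filter (\<lambda>a. n < a) X"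
    using assms(4) by (auto intro!: filter_cong)
  moreover obtain q where "filter (\<lambda>a. n < a) X = [Suc n..<Suc D] @ q"
    using assms(6) unfolding aligned_def prefix_def by auto
  ultimately have "filter (\<lambda>a. l < a) (s @ filter (\<lambda>b. b \<notin> set s) X) = ([Suc l..<Suc n] @ [Suc n..<Suc D]) @ q"
    using assms(3) by simp
  then show "prefix [Suc l..<Suc D] (filter (\<lambda>a. l < a) (s @ filter (\<lambda>b. b \<notin> set s) X))"
    using upt_append[of "Suc l" "Suc n" "Suc D"] assms(4,5) by (simp add: prefix_def del: upt_Suc)
qed (use assms in auto)

lemma aligned_word_pull_full:
  assumes "distinct s" "0 \<notin> set s" "filter (\<lambda>a. l < a) s = [Suc l..<Suc D] @ t" "l \<le> D"
  shows "aligned_word (pull s X) l"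
  by (rule aligned_word_pull_aux) (use assms in \<open>auto simp: prefix_def simp del: upt_Suc\<close>)

text \<open>Reads off the letter \<open>a\<close> from a vertex on the path that starts with \<open>mtf a X\<close>; the value 0
  marks the two end vertices.\<close>

definition lab :: "(nat list \<Rightarrow> nat) \<Rightarrow> nat list \<Rightarrow> nat" where
  "lab f V = (if V = X \<or> V = [1..<Suc D] then 0 else if V = mtf (hd V) X then hd V
     else if hd V = 1 then (case brk D (tl V) of (u, v) \<Rightarrow> if m < u then u else if v = x then m else v)
     else f V)"

section \<open>Evaluation of the labels\<close>

lemma mtf_neq_X: "a \<noteq> x \<Longrightarrow> mtf a X \<noteq> X"
  unfolding x_def by (metis X_ne hd_mtf)

lemma lab_X [simp]: "lab f X = 0" and lab_target [simp]: "lab f [1..<Suc D] = 0"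
  by (auto simp: lab_def simp del: upt_Suc)

lemma lab_mtf: "a \<noteq> x \<Longrightarrow> mtf a X \<noteq> [1..<Suc D] \<Longrightarrow> lab f (mtf a X) = a"
  using mtf_neq_X[of a] by (simp add: lab_def del: upt_Suc)

lemma mtf_second: "2 \<le> D \<Longrightarrow> a \<noteq> x \<Longrightarrow> \<exists>r. mtf a X = a # x # r"
proof -
  assume a: "2 \<le> D" "a \<noteq> x"
  have "length (tl X) = D - 1" using X(1) by simp
  then have "mtf a X = take D (a # x # filter (\<lambda>b. b \<noteq> a) (tl X))"
    using a X(1) by (simp add: mtf_def filter_X)
  moreover obtain k where "D = Suc (Suc k)" using a(1) by (metis add_2_eq_Suc le_Suc_ex)
  ultimately show ?thesis by simp
qed

lemma mtf_x [simp]: "mtf x X = X"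
proof -
  have "x \<notin> set (tl X)" using X(2) X_eq by (metis distinct.simps(2))
  then have "filter (\<lambda>b. b \<noteq> x) X = tl X" by (subst X_eq) (simp add: filter_neq_id)
  then show ?thesis by (simp add: mtf_def X_eq[symmetric])
qed

lemma lab_high:
  assumes "V = k # r" "2 \<le> k" "V \<noteq> X" "V = mtf k X \<Longrightarrow> k = a" "f V = a"
  shows "lab f V = a"
  using assms D by (auto simp: lab_def upt_conv_Cons simp del: upt_Suc)

text \<open>Vertices that start with 1 are read in the same way in all cases of
  \<open>x_cases\<close>. A second letter other than 2 keeps them apart from the target.\<close>

lemma lab_one:
  assumes "V = 1 # U" "U = p # r" "p \<noteq> 2" "V \<noteq> X" "V \<noteq> mtf 1 X" "brk D U = (u, v)"
    and "(if m < u then u else if v = x then m else v) = a"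
  shows "lab f V = a"
proof -
  have "V \<noteq> [1..<Suc D]"
  proof
    assume "V = [1..<Suc D]"
    moreover from this assms(1,2) have "length [1..<Suc D] = 2 + length r" by (metis length_Cons add_2_eq_Suc)
    then have "[1..<Suc D] = 1 # 2 # [3..<Suc D]"
      by (auto simp: upt_conv_Cons numeral_eq_Suc simp del: upt_Suc)
    ultimately show False using assms by simp
  qed
  then show ?thesis using assms by (auto simp: lab_def simp del: upt_Suc)
qed

lemma pull_prefix: "length u \<le> D \<Longrightarrow> \<exists>r. pull (u @ t) X = u @ r"
  by (simp add: pull_def X(1))

lemma pull_run:
  assumes "2 \<le> k" "k \<le> l" "l \<le> D"
  shows "\<exists>r. pull ([k..<Suc l] @ z # t) X = [k..<Suc l] @ z # r"
  using pull_prefix[of "[k..<Suc l] @ [z]" t] assms by (auto simp del: upt_Suc)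

lemma pull_run_one:
  assumes "3 \<le> k" "k \<le> l" "l \<le> D"
  shows "\<exists>r. pull (1 # [k..<Suc l] @ z # t) X = 1 # [k..<Suc l] @ z # r"
  using pull_prefix[of "1 # [k..<Suc l] @ [z]" t] assms by (auto simp del: upt_Suc)

lemma pull_snoc_x:
  assumes "x \<notin> set s" "length s < D"
  shows "\<exists>r. pull s X = s @ x # r"
proof -
  obtain d where "D - length s = Suc d" using assms(2) by (metis Suc_diff_Suc)
  then have "pull s X = s @ take (Suc d) (filter (\<lambda>b. b \<notin> set s) X)"
    using assms unfolding pull_def X(1) by simp
  then show ?thesis using assms(1) by (simp add: filter_X)
qed

lemma upt_snoc: "k \<le> l \<Longrightarrow> [k..<Suc l] = k # [Suc k..<Suc l]"
  by (simp add: upt_conv_Cons)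

text \<open>Letters are positive, so the label 0 keeps the paths away from both end vertices, while
  different labels keep the paths apart. The move that leads straight to the target starts no
  path.\<close>

definition separated where
  "separated L \<longleftrightarrow> L X = 0 \<and> L [1..<Suc D] = 0 \<and>
     (\<forall>a \<in> {1..\<Delta> + 1} - {x}. mtf a X \<noteq> [1..<Suc D] \<longrightarrow> (\<exists>w. route a w L))"

lemma separatedI:
  assumes "\<And>a. a \<in> {1..\<Delta> + 1} \<Longrightarrow> a \<noteq> x \<Longrightarrow> mtf a X \<noteq> [1..<Suc D] \<Longrightarrow> \<exists>w. route a w (lab f)"
  shows "separated (lab f)"
  unfolding separated_def
proof (intro conjI ballI impI)
  fix a assume "a \<in> {1..\<Delta> + 1} - {x}" "mtf a X \<noteq> [1..<Suc D]"
  then show "\<exists>w. route a w (lab f)" by (intro assms) auto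
qed (rule lab_X lab_target)+

lemma lab_run:
  assumes "V = [k..<Suc l] @ z # r" "2 \<le> k" "k \<le> l" "l \<le> D" "z \<noteq> Suc l \<or> l = D"
    and "V \<noteq> X" "V = mtf k X \<Longrightarrow> k = a" "\<And>V. brk D V = (l, z) \<Longrightarrow> f V = a"
  shows "lab f V = a"
proof (rule lab_high[of V k])
  show "V = k # [Suc k..<Suc l] @ z # r" using assms(1,3) upt_snoc[of k l] by simp
  show "f V = a" using assms(1) brk_upt[OF assms(3-5)] assms(8) by simp
qed (use assms in auto)

lemma lab_run_one:
  assumes "V = 1 # [p..<Suc l] @ z # r" "3 \<le> p" "p \<le> l" "l \<le> D" "z \<noteq> Suc l \<or> l = D"
    and "V \<noteq> X" "V \<noteq> mtf 1 X" "(if m < l then l else if z = x then m else z) = a"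
  shows "lab f V = a"
proof (rule lab_one[of V])
  show "V = 1 # [p..<Suc l] @ z # r" by fact
  show "[p..<Suc l] @ z # r = p # [Suc p..<Suc l] @ z # r" using assms(3) upt_snoc[of p l] by simp
  show "brk D ([p..<Suc l] @ z # r) = (l, z)" by (rule brk_upt[OF assms(3-5)])
qed (use assms in auto)

text \<open>The second letter of an out-neighbour is \<open>x\<close>; this limits which vertices
  inside a path can coincide with an out-neighbour of \<open>X\<close>.\<close>

lemma run_second:
  assumes "2 \<le> D" "[k..<Suc l] @ z # r = mtf k X" "k \<le> l" "k \<noteq> x"
  shows "if k < l then Suc k = x else z = x"
proof -
  obtain q where q: "mtf k X = k # x # q" using mtf_second[OF assms(1,4)] by blast
  show ?thesis
  proof (cases "k < l")
    case True
    then have "[k..<Suc l] = k # Suc k # [Suc (Suc k)..<Suc l]"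
      using upt_snoc[of k l] upt_snoc[of "Suc k" l] by simp
    then show ?thesis using assms(2) q True by (simp del: upt_Suc)
  next
    case False
    then have "[k..<Suc l] = [k]" using assms(3) by simp
    then show ?thesis using assms(2) q False by (simp del: upt_Suc)
  qed
qed

section \<open>The case of a first letter outside \<open>{2..D}\<close>\<close>

definition low_rule :: "nat list \<Rightarrow> nat" where
  "low_rule V = (case brk D V of (u, v) \<Rightarrow>
     if v = x then u else if u = D then v else if v = 1 then u else v)"

text \<open>Letters outside \<open>{2..D}\<close> take \<open>route_below\<close>, those below
  \<open>m\<close> \<open>route_split\<close>, the others \<open>route_within\<close>. In the last
  family \<open>x\<close>, which is never moved, follows the run. So the breaks are
  \<open>(D, a)\<close>; \<open>(m, a)\<close> or \<open>(a, 1)\<close>; and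
  \<open>(a, x)\<close>.\<close>

lemma separated_low:
  assumes x: "x \<notin> {2..D}"
  shows "separated (lab low_rule)"
proof -
  have first: "lab low_rule V = a" if V: "V = [k..<Suc l] @ z # r" "2 \<le> k" "k \<le> l" "l \<le> D" "z \<noteq> Suc l \<or> l = D"
    and "k = l \<Longrightarrow> z = x \<Longrightarrow> k = a" "(if z = x then l else if l = D then z else if z = 1 then l else z) = a"
    for V k l z r a
  proof (rule lab_run[OF V])
    have "hd V = k" using V upt_snoc[of k l] by (simp del: upt_Suc)
    then show "V \<noteq> X" using x V unfolding x_def by auto
    show "k = a" if "V = mtf k X"
      using run_second[of k l z r] that V x \<open>k = l \<Longrightarrow> z = x \<Longrightarrow> k = a\<close> by (auto split: if_splits)
    show "low_rule V' = a" if "brk D V' = (l, z)" for V'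
      using that assms \<open>(if z = x then l else _) = a\<close> by (simp add: low_rule_def)
  qed
  have "\<exists>w. route a w (lab low_rule)" if a: "a \<in> {1..\<Delta> + 1}" "a \<noteq> x" "mtf a X \<noteq> [1..<Suc D]" for a
  proof -
    note L0 = lab_mtf[OF a(2,3), of low_rule]
    consider "a \<notin> {2..D}" | "2 \<le> a" "a < m" | "2 \<le> a" "m \<le> a" "a \<le> D"
      using m_le by force
    then show ?thesis
    proof cases
      case 1
      \<comment> \<open>For \<open>D = 1\<close> the move of 1 would lead straight to the
        target.\<close>
      have "a = 1 \<longrightarrow> 2 \<le> D"
      proof (rule ccontr)
        assume "\<not> ?thesis"
        then have "D = 1" "a = 1" using D by auto
        then show False using a(3) X(1) by (simp add: mtf_def)
      qed
      moreover have "lab low_rule (pull ([k..<Suc D] @ [a]) X) = a" if "2 \<le> k" "k \<le> D" for k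
        using pull_run[OF that, of a "[]"] 1 a that by (auto intro!: first)
      ultimately show ?thesis using route_below[of a D] a 1 L0 by blast
    next
      case 2
      obtain z where z: "z > m" "prec X z m" using ex_prec_m by blast
      have ax: "a < D" using 2 m_le by simp
      have l1: "lab low_rule (pull ([k..<Suc m] @ [a]) X) = a" if "a < k" "k \<le> m" for k
        using pull_run[of k m a "[]"] 2 that x ax m_le a by (auto intro!: first)
      have l3: "lab low_rule (pull ([k..<Suc a] @ 1 # [Suc a..<Suc m]) X) = a" if "2 \<le> k" "k \<le> a" for k
        using pull_run[of k a 1 "[Suc a..<Suc m]"] 2 that x ax m_le a by (auto intro!: first simp del: upt_Suc)
      have l2: "lab low_rule (pull (1 # [Suc a..<Suc m] @ [a]) X) = a"
      proof -
        obtain r where r: "pull (1 # [Suc a..<Suc m] @ [a]) X = 1 # [Suc a..<Suc m] @ a # r"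
          using pull_run_one[of "Suc a" m a "[]"] 2 m_le by auto
        let ?V = "1 # [Suc a..<Suc m] @ a # r"
        \<comment> \<open>If \<open>x = 1\<close>, both vertices on the right are \<open>X\<close>,
          and equality would align \<open>X\<close> at \<open>a < m\<close>. Otherwise the first
          letter excludes \<open>X\<close>, and the second one, \<open>a + 1\<close> against
          \<open>x\<close>, excludes \<open>mtf 1 X\<close>.\<close>
        have "?V \<noteq> X \<and> ?V \<noteq> mtf 1 X"
        proof (cases "x = 1")
          case True
          have "?V \<noteq> X"
          proof
            assume "?V = X"
            then have "filter (\<lambda>b. a < b) X = filter (\<lambda>b. a < b) ?V" by simp
            also have "\<dots> = [Suc a..<Suc m] @ filter (\<lambda>b. a < b) r"
              using 2 by (auto simp: filter_id_conv simp del: upt_Suc)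
            finally show False using filter_above_m_run not_aligned 2 by blast
          qed
          then show ?thesis using True mtf_x by simp
        next
          case False
          have "?V = 1 # Suc a # [Suc (Suc a)..<Suc m] @ a # r"
            using 2 upt_snoc[of "Suc a" m] by simp
          moreover have "?V \<noteq> X" using False unfolding x_def by (metis list.sel(1))
          moreover have "Suc a \<noteq> x" using 2 x ax by auto
          moreover obtain q where "mtf 1 X = 1 # x # q" using mtf_second[of 1] False 2 ax by fastforce
          ultimately show ?thesis by (metis list.inject)
        qed
        then show ?thesis unfolding r
          by (intro lab_run_one[OF refl]) (use 2 m_le a in auto)
      qed
      show ?thesis
        by (rule exI, rule route_split[OF _ _ m_le aligned_m z(1) _ L0 l1 l2 l3]) (use 2 z in auto)
    next
      case 3
      have "lab low_rule (pull [k..<Suc a] X) = a" if "2 \<le> k" "k < a" for k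
      proof -
        have "x \<notin> set [k..<Suc a]" "length [k..<Suc a] < D" using x 3 that by (auto simp del: upt_Suc)
        from pull_snoc_x[OF this] obtain r where r: "pull [k..<Suc a] X = [k..<Suc a] @ x # r" by blast
        show ?thesis using 3 that x by (intro first[OF r]) auto
      qed
      then show ?thesis using route_within[of a] 3 aligned_ge L0 by blast
    qed
  qed
  then show ?thesis by (rule separatedI)
qed

section \<open>The case of a first letter from 2 to \<open>m - 1\<close>\<close>

definition middle_rule :: "nat list \<Rightarrow> nat" where
  "middle_rule V = (case brk D V of (u, v) \<Rightarrow>
     if u = D then if v = x then D else v
     else if m < u then u
     else if u = m then if v = 1 then D else if v = x then m else v
     else if u = x then m else u)"

text \<open>A letter \<open>a\<close> of \<open>{2..D}\<close> normally reaches the in-neighbour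
  with 1 behind \<open>a\<close>. As \<open>x\<close> starts no path, its in-neighbour goes to
  \<open>m\<close>; if \<open>m < D\<close>, that of \<open>m\<close> goes to \<open>D\<close>. The
  vertex \<open>2 .. D 1\<close> belongs to \<open>a = 1\<close>. The rule inverts this
  assignment.\<close>

lemma separated_middle:
  assumes x: "2 \<le> x" "x < m"
  shows "separated (lab middle_rule)"
proof -
  have D2: "2 \<le> D" using x m_le by simp
  have nal: "\<not> aligned (x - 1)" using not_aligned x by simp
  have filt: "filter (\<lambda>a. x - 1 < a) [k..<n] = [x..<n]" if "1 \<le> k" "k \<le> x" for k n
    using filter_less_upt[of "k - 1" "x - 1" n] that x by simp
  have filt': "filter (\<lambda>a. x - 1 < a) [k..<n] = [k..<n]" if "x \<le> k" for k n
    using that x by (auto simp: filter_id_conv)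
  \<comment> \<open>Only \<open>k = x\<close> could make \<open>V\<close> equal to \<open>X\<close>,
    and only \<open>k = x - 1\<close> to an out-neighbour \<open>mtf k X\<close>. Both are excluded
    by alignment at \<open>x - 1\<close>, which \<open>X\<close> lacks.\<close>
  have run: "lab middle_rule V = a" if V: "V = [k..<Suc l] @ z # r" "2 \<le> k" "k \<le> l" "l \<le> D" "z \<noteq> Suc l \<or> l = D"
    and zx: "k = l \<Longrightarrow> z \<noteq> x" and al: "k = x \<or> Suc k = x \<Longrightarrow> aligned_word V (x - 1)"
    and val: "(if l = D then if z = x then D else z else if m < l then l
         else if l = m then if z = 1 then D else if z = x then m else z
         else if l = x then m else l) = a"
    for V k l z r a
  proof (rule lab_run[OF V])
    have hd: "hd V = k" using V upt_snoc[of k l] by (simp del: upt_Suc)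
    show VX: "V \<noteq> X"
    proof
      assume "V = X"
      then show False using hd al nal aligned_word_X unfolding x_def by auto
    qed
    show "k = a" if "V = mtf k X"
    proof -
      have "k \<noteq> x" using VX that by auto
      then have "Suc k = x" using run_second[OF D2, of k l z r] that V zx by (auto split: if_splits)
      then have "aligned_word (mtf k X) (x - 1)" using al that by simp
      then show ?thesis using aligned_word_mtf nal \<open>Suc k = x\<close> by fastforce
    qed
    show "middle_rule V' = a" if "brk D V' = (l, z)" for V'
      using that val by (simp add: middle_rule_def)
  qed
  have one: "lab middle_rule V = a" if V: "V = 1 # [p..<Suc l] @ z # r" "3 \<le> p" "p \<le> l" "l \<le> D" "z \<noteq> Suc l \<or> l = D"
    and al: "p = x \<Longrightarrow> aligned_word V (x - 1)" and val: "(if m < l then l else if z = x then m else z) = a"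
    for V p l z r a
  proof (rule lab_run_one[OF V])
    show "V \<noteq> X" using V x unfolding x_def by auto
    show "V \<noteq> mtf 1 X"
    proof
      assume V1: "V = mtf 1 X"
      have "V = 1 # p # [Suc p..<Suc l] @ z # r" using V upt_snoc[of p l] by simp
      then have "p = x" using V1 mtf_second[OF D2, of 1] x by auto
      then show False using al V1 aligned_word_mtf[of 1 "x - 1"] x nal by auto
    qed
  qed (rule val)
  have shifted: "\<exists>w. route l w (lab middle_rule)"
    if q: "2 \<le> q" "q < l" "l \<le> D" "aligned l" "x \<le> q"
      and L0: "lab middle_rule (mtf l X) = l" and qm: "q = x \<and> l = m \<or> q = m \<and> l = D" for q l
  proof -
    have "lab middle_rule (pull [k..<Suc l] X) = l" if "q < k" "k < l" for k
    proof -
      have "\<exists>r. pull [k..<Suc l] X = [k..<Suc l] @ x # r"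
        using q x that by (intro pull_snoc_x) (auto simp del: upt_Suc)
      then show ?thesis using q x that qm by (auto intro!: run simp del: upt_Suc)
    qed
    moreover have "lab middle_rule (pull (1 # [Suc q..<Suc l]) X) = l"
    proof -
      have "\<exists>r. pull (1 # [Suc q..<Suc l]) X = (1 # [Suc q..<Suc l]) @ x # r"
        using q x by (intro pull_snoc_x) (auto simp del: upt_Suc)
      then show ?thesis using q x qm by (auto intro!: one simp del: upt_Suc)
    qed
    moreover have "lab middle_rule (pull ([k..<Suc q] @ 1 # [Suc q..<Suc l]) X) = l" if k: "2 \<le> k" "k \<le> q" for k
    proof -
      let ?s = "[k..<Suc q] @ 1 # [Suc q..<Suc l]"
      have "aligned_word (pull ?s X) (x - 1)" if "k = x \<or> Suc k = x"
      proof (rule aligned_word_pull)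
        have "filter (\<lambda>a. x - 1 < a) ?s = [x..<Suc q] @ [Suc q..<Suc l]"
          using filt[of k "Suc q"] filt'[of "Suc q" "Suc l"] that k q x by (auto simp del: upt_Suc)
        also have "\<dots> = [Suc (x - 1)..<Suc l]" using upt_append[of x "Suc q" "Suc l"] q x by (simp del: upt_Suc)
        finally show "filter (\<lambda>a. x - 1 < a) ?s = [Suc (x - 1)..<Suc l]" .
      qed (use k q x in \<open>auto simp del: upt_Suc\<close>)
      then show ?thesis
        using pull_run[of k q 1 "[Suc q..<Suc l]"] q k x qm m_le by (auto intro!: run simp del: upt_Suc)
    qed
    ultimately show ?thesis using route_shifted[of q l] q L0 by blast
  qed
  have split: "\<exists>w. route j w (lab middle_rule)"
    if j: "2 \<le> j" "j \<le> l" "l < D \<or> l = m" "l \<le> D" "m \<le> l" "j \<noteq> x"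
      and L0: "lab middle_rule (mtf j X) = j" and z: "z > l" "prec X z (if j = l then 1 else l)"
      and lj: "l = m \<and> j < m \<or> l = j \<and> m < j" for j l z
  proof -
    have "lab middle_rule (pull ([k..<Suc l] @ [j]) X) = j" if k: "j < k" "k \<le> l" for k
    proof -
      have "aligned_word (pull ([k..<Suc l] @ [j]) X) (x - 1)" if "k = x \<or> Suc k = x"
      proof (rule aligned_word_pull)
        have "j < x" using that k j by auto
        then show "filter (\<lambda>a. x - 1 < a) ([k..<Suc l] @ [j]) = [Suc (x - 1)..<Suc l]"
          using filt[of k "Suc l"] that k j x by (auto simp del: upt_Suc)
      qed (use k j x in \<open>auto simp del: upt_Suc intro: aligned_ge\<close>)
      then show ?thesis
        using pull_run[of k l j "[]"] j k x lj by (auto intro!: run simp del: upt_Suc)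
    qed
    moreover have "lab middle_rule (pull (1 # [Suc j..<Suc l] @ [j]) X) = j"
    proof (cases "j = l")
      case False
      then have l: "l = m" "j < m" using lj j by auto
      let ?s = "1 # [Suc j..<Suc l] @ [j]"
      have "aligned_word (pull ?s X) (x - 1)" if "Suc j = x"
      proof (rule aligned_word_pull)
        show "filter (\<lambda>a. x - 1 < a) ?s = [Suc (x - 1)..<Suc l]"
          using filt[of "Suc j" "Suc l"] that j x by (auto simp del: upt_Suc)
      qed (use j x l m_le in \<open>auto simp del: upt_Suc intro: aligned_ge\<close>)
      then show ?thesis
        using pull_run_one[of "Suc j" l j "[]"] j x l by (auto intro!: one simp del: upt_Suc)
    next
      case True
      then have l: "l = j" "m < j" using lj by auto
      have "\<exists>r. pull [1, j] X = [1, j] @ x # r"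
        using l x j by (intro pull_snoc_x) auto
      then have "\<exists>r. pull [1, j] X = 1 # [j..<Suc j] @ x # r" by simp
      then show ?thesis using l x j by (auto intro!: one simp del: upt_Suc)
    qed
    moreover have "lab middle_rule (pull ([k..<Suc j] @ 1 # [Suc j..<Suc l]) X) = j" if k: "2 \<le> k" "k \<le> j" for k
    proof -
      let ?s = "[k..<Suc j] @ 1 # [Suc j..<Suc l]"
      have "aligned_word (pull ?s X) (x - 1)" if "k = x \<or> Suc k = x"
      proof (rule aligned_word_pull)
        have "filter (\<lambda>a. x - 1 < a) ?s = [x..<Suc j] @ [Suc j..<Suc l]"
          using filt[of k "Suc j"] filt'[of "Suc j" "Suc l"] that k x by (auto simp del: upt_Suc)
        also have "\<dots> = [Suc (x - 1)..<Suc l]" using upt_append[of x "Suc j" "Suc l"] that k j x by (auto simp del: upt_Suc)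
        finally show "filter (\<lambda>a. x - 1 < a) ?s = [Suc (x - 1)..<Suc l]" .
      qed (use k j x in \<open>auto simp del: upt_Suc intro: aligned_ge\<close>)
      then show ?thesis
        using pull_run[of k j 1 "[Suc j..<Suc l]"] j k x lj m_le by (auto intro!: run simp del: upt_Suc)
    qed
    ultimately show ?thesis using route_split[of j l z] j z L0 aligned_ge by blast
  qed
  have "\<exists>w. route a w (lab middle_rule)" if a: "a \<in> {1..\<Delta> + 1}" "a \<noteq> x" "mtf a X \<noteq> [1..<Suc D]" for a
  proof -
    note L0 = lab_mtf[OF a(2,3), of middle_rule]
    consider "a \<notin> {2..D}" | "2 \<le> a" "a < m" | "a = m" | "m < a" "a < D" | "m < a" "a = D"
      using m_le by force
    then show ?thesis
    proof cases
      case 1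
      have "lab middle_rule (pull ([k..<Suc D] @ [a]) X) = a" if k: "2 \<le> k" "k \<le> D" for k
      proof -
        have "aligned_word (pull ([k..<Suc D] @ [a]) X) (x - 1)" if "k = x \<or> Suc k = x"
        proof (rule aligned_word_pull_full)
          show "filter (\<lambda>a. x - 1 < a) ([k..<Suc D] @ [a]) = [Suc (x - 1)..<Suc D] @ filter (\<lambda>a. x - 1 < a) [a]"
            using filt[of k "Suc D"] that k x by (auto simp del: upt_Suc)
        qed (use k 1 x a m_le in \<open>auto simp del: upt_Suc\<close>)
        then show ?thesis
          using pull_run[of k D a "[]"] 1 k x a by (auto intro!: run simp del: upt_Suc)
      qed
      then show ?thesis using route_below[of a D] a 1 L0 D2 by blast
    next
      case 2
      obtain z where "z > m" "prec X z m" using ex_prec_m by blast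
      then show ?thesis using 2 split[of a m z] m_le L0 a by auto
    next
      case 3
      then show ?thesis using shifted[of x m] x m_le aligned_m L0 by auto
    next
      case 4
      show ?thesis
      \<comment> \<open>Either way the path ends with 1 right behind \<open>a\<close>. If 1 stands
        before \<open>a + 1\<close> in \<open>X\<close>, it gets there by itself, and a word that
        moves it would not be shortest.\<close>
      proof (cases "prec X (Suc a) 1")
        case True
        then show ?thesis using 4 x split[of a a "Suc a"] m_le L0 a by auto
      next
        case False
        moreover have "Suc a \<in> set X" using aligned_in_set[of a "Suc a"] 4 by simp
        ultimately have p: "prec X 1 (Suc a)" using prec_total[of "Suc a" X 1] 4 by auto
        have "lab middle_rule (pull [k..<Suc a] X) = a" if k: "2 \<le> k" "k < a" for k
        proof -
          let ?F = "filter (\<lambda>b. b \<notin> set [k..<Suc a]) X"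
          have "prec ?F 1 (Suc a)" using p k by (subst prec_filter) (auto simp del: upt_Suc)
          \<comment> \<open>As 1 comes earlier than \<open>a + 1\<close>, the first unmoved letter
            is not \<open>a + 1\<close>, and the run breaks at \<open>a\<close>.\<close>
          then obtain z q where F: "?F = z # q" "z \<noteq> Suc a" by (cases ?F) auto
          have "length [k..<Suc a] < D" using k 4 by (auto simp del: upt_Suc)
          then obtain d where "D - length [k..<Suc a] = Suc d" by (metis Suc_diff_Suc)
          then have pl: "pull [k..<Suc a] X = [k..<Suc a] @ z # take d q"
            using 4 k F unfolding pull_def X(1) by (simp del: upt_Suc)
          have "aligned_word (pull [k..<Suc a] X) (x - 1)" if "k = x \<or> Suc k = x"
          proof (rule aligned_word_pull)
            show "filter (\<lambda>a. x - 1 < a) [k..<Suc a] = [Suc (x - 1)..<Suc a]"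
              using filt[of k "Suc a"] that k x by (auto simp del: upt_Suc)
          qed (use k 4 x in \<open>auto simp del: upt_Suc intro: aligned_ge\<close>)
          then show ?thesis using 4 k F x pl by (intro run[OF pl]) auto
        qed
        then show ?thesis using route_within[of a] 4 x aligned_ge L0 by auto
      qed
    next
      case 5
      then show ?thesis using shifted[of m D] x m_le aligned_D L0 by auto
    qed
  qed
  then show ?thesis by (rule separatedI)
qed

section \<open>The case of the first letter \<open>m + 1\<close>\<close>

text \<open>If \<open>x = m + 1\<close>, the letters \<open>2, \<dots>, m\<close> may interrupt the runs that matter; they are masked here.\<close>

definition beyond :: "nat list \<Rightarrow> nat list" where
  "beyond V = filter (\<lambda>a. a = 1 \<or> m < a) V"

lemma beyond_append [simp]: "beyond (U @ V) = beyond U @ beyond V"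
  by (simp add: beyond_def)

lemma beyond_Cons [simp]: "beyond (a # V) = (if a = 1 \<or> m < a then a # beyond V else beyond V)"
  by (simp add: beyond_def)

lemma beyond_upt: "2 \<le> k \<Longrightarrow> beyond [k..<n] = [max k (Suc m)..<n]"
  by (induction n) (auto simp: beyond_def max_def)

lemma beyond_filter: "beyond (filter P V) = filter P (beyond V)"
  unfolding beyond_def by (simp add: conj_commute)

text \<open>By alignment the letters above \<open>m\<close> start with \<open>m + 1\<close>, ...,
  \<open>D\<close>. So the masked word counts upwards until 1 interrupts it or a letter above
  \<open>D\<close> follows; one of these occurs, since the \<open>D\<close> letters of
  \<open>X\<close> do not fit into \<open>{2..D}\<close>.\<close>

lemma beyond_X:
  assumes x: "x = Suc m" "x \<le> D"
  obtains e f r where "beyond X = [x..<Suc e] @ f # r" "x \<le> e" "e \<le> D" "f = 1 \<or> e = D \<and> D < f" "f \<in> set X"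
proof -
  note found = that
  obtain q where q: "filter (\<lambda>a. m < a) X = [Suc m..<Suc D] @ q"
    using aligned_m unfolding aligned_def prefix_def by auto
  have d: "distinct ([Suc m..<Suc D] @ q)" using X(2) q by (metis distinct_filter)
  have qD: "D < a" if "a \<in> set q" for a
  proof -
    have "a \<in> set (filter (\<lambda>a. m < a) X)" using q that by simp
    then have "m < a" by simp
    moreover have "a \<notin> set [Suc m..<Suc D]" using d that by auto
    ultimately show ?thesis by (auto simp del: upt_Suc)
  qed
  have sub: "set (beyond X) \<subseteq> set X" by (auto simp: beyond_def)
  have fm: "filter (\<lambda>a. m < a) (beyond X) = [Suc m..<Suc D] @ q"
    unfolding q[symmetric] beyond_def by (auto intro!: filter_cong)
  have full: thesis if b: "beyond X = [Suc m..<Suc D] @ g # r" "g = 1 \<or> D < g" for g r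
  proof (rule found)
    show "beyond X = [x..<Suc D] @ g # r" using b x by simp
    have "g \<in> set (beyond X)" using b(1) by simp
    then show "g \<in> set X" using sub by blast
  qed (use x b in auto)
  show thesis
  proof (cases "1 \<in> set (beyond X)")
    case False
    then have b: "beyond X = [Suc m..<Suc D] @ q"
      using fm by (subst (asm) filter_True) (auto simp: beyond_def)
    have "q \<noteq> []"
    proof
      assume "q = []"
      then have "set (filter (\<lambda>a. m < a) X) = {Suc m..D}" using q by (auto simp del: upt_Suc)
      moreover have "1 \<notin> set X" using False by (auto simp: beyond_def)
      moreover have "b \<in> {2..D}" if b: "b \<in> set X" "1 \<notin> set X" "set (filter (\<lambda>a. m < a) X) = {Suc m..D}" for b
      proof -
        have "b \<in> {Suc m..D}" if "m < b" using b that by (metis (mono_tags, lifting) filter_set mem_Collect_eq set_filter)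
        then have "b \<le> D" using m_le by force
        moreover have "b \<noteq> 1" "1 \<le> b" using b X_pos by auto
        ultimately show ?thesis by simp
      qed
      ultimately have "set X \<subseteq> {2..D}" by blast
      then have "card (set X) \<le> card {2..D}" by (intro card_mono) auto
      then show False using X(1,2) D by (simp add: distinct_card)
    qed
    then show thesis using full b qD by (cases q) auto
  next
    case True
    then obtain p q' where b: "beyond X = p @ 1 # q'" "1 \<notin> set p" by (metis split_list_first)
    have "set p \<subseteq> set (beyond X)" using b by auto
    then have p: "filter (\<lambda>a. m < a) p = p" using b(2) by (auto simp: filter_id_conv beyond_def)
    have pq: "p @ filter (\<lambda>a. m < a) q' = [Suc m..<Suc D] @ q"
      using fm m_ge unfolding b by (simp add: p)
    show thesis
    \<comment> \<open>The letters before 1 either form a beginning of the run, possibly all of it,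
      and then \<open>f = 1\<close>; or they contain the whole run and a letter above
      \<open>D\<close>, which is then \<open>f\<close>.\<close>
    proof (cases "length p \<le> D - m")
      case True
      then have "p = take (length p) ([Suc m..<Suc D] @ q)" using pq by (metis append_eq_conv_conj)
      also have "\<dots> = [Suc m..<Suc m + length p]" using True x by (simp add: take_upt del: upt_Suc)
      finally have p2: "p = [x..<Suc (m + length p)]" using x by simp
      have "hd (beyond X) = x" using filter_X[of "\<lambda>a. a = 1 \<or> m < a"] x unfolding beyond_def by simp
      then have "p \<noteq> []" using b(1) x m_ge by auto
      then have "x \<le> m + length p" using x by (cases p) auto
      then show thesis using found[of "m + length p" 1 q'] b p2 True x m_ge m_le sub by auto
    next
      case False
      let ?U = "[Suc m..<Suc D]"
      have lU: "length ?U < length p" using False by (simp del: upt_Suc)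
      obtain us where us: "p = ?U @ us \<and> us @ filter (\<lambda>a. m < a) q' = q \<or> p @ us = ?U"
        using pq unfolding append_eq_append_conv2 by blast
      have "p @ us \<noteq> ?U"
      proof
        assume "p @ us = ?U"
        then have "length p \<le> length ?U" by (metis length_append le_add1)
        then show False using lU by simp
      qed
      then obtain p' where p': "p = ?U @ p'" "q = p' @ filter (\<lambda>a. m < a) q'"
        using us by blast
      then have "p' \<noteq> []" using lU by (metis append_Nil2 less_irrefl)
      then obtain g r where g: "p' = g # r" by (cases p') auto
      then show thesis using full[of g "r @ 1 # q'"] b(1) p' qD[of g] by (simp del: upt_Suc)
    qed
  qed
qed

text \<open>At most \<open>m - 1\<close> letters are masked, so \<open>D - m + 1\<close> letters
  stay visible after truncation: enough for a run within \<open>m + 1\<close>, ..., \<open>D\<close>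
  and the letter behind it.\<close>

lemma brk_beyond_pull:
  assumes "distinct s" "0 \<notin> set s" "prefix ([p..<Suc g] @ [w]) (beyond (s @ filter (\<lambda>b. b \<notin> set s) X))"
    and "Suc m \<le> p" "p \<le> g" "g \<le> D" "w \<noteq> Suc g \<or> g = D"
  shows "brk D (beyond (pull s X)) = (g, w)"
proof -
  have "prefix ([p..<Suc g] @ [w]) (beyond (pull s X))"
    unfolding beyond_def pull_def
  proof (rule prefix_filter_take[where B = "{2..m}"])
    show "prefix ([p..<Suc g] @ [w]) (filter (\<lambda>a. a = 1 \<or> m < a) (s @ filter (\<lambda>b. b \<notin> set s) X))"
      using assms(3) unfolding beyond_def .
    show "distinct (s @ filter (\<lambda>b. b \<notin> set s) X)" using assms(1) X(2) by auto
    show "a \<in> {2..m}" if "a \<in> set (s @ filter (\<lambda>b. b \<notin> set s) X)" "\<not> (a = 1 \<or> m < a)" for a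
    proof -
      have "1 \<le> a" using that(1) assms(2) X_pos by (cases "a = 0") auto
      then show ?thesis using that(2) by auto
    qed
    show "length X \<le> length (s @ filter (\<lambda>b. b \<notin> set s) X)"
      using length_filter_notin[OF X(2), of s] by simp
  qed (use assms X(1) m_ge in \<open>auto simp del: upt_Suc\<close>)
  then obtain r where "beyond (pull s X) = [p..<Suc g] @ w # r" by (auto simp: prefix_def)
  then show ?thesis using brk_upt[OF assms(5-7)] by simp
qed

text \<open>Breaks at or below \<open>m\<close> come from the paths of 1 and of the letters below
  \<open>m\<close>. Beyond \<open>m\<close> the masked word decides, and its break
  \<open>(e, f)\<close> in \<open>X\<close> itself is the mark of the path of
  \<open>m\<close>.\<close>

definition adjacent_rule :: "nat \<Rightarrow> nat \<Rightarrow> nat list \<Rightarrow> nat" where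
  "adjacent_rule e f V = (case brk D V of (u, v) \<Rightarrow>
     if u \<le> m then if v = 1 then if u = m then 1 else u else v
     else (case brk D (beyond V) of (g, w) \<Rightarrow>
       if w = x then g
       else if (g, w) = (e, f) then m
       else if w = 1 then if g = D then if e < D then D else f else if g = x then e else g
       else w))"

text \<open>For \<open>m \<ge> 2\<close> the path of \<open>m\<close> ends in the in-neighbour that
  begins with \<open>2 .. e f\<close>, and 1 takes the one with 1 behind \<open>m\<close>. A letter
  \<open>e > x\<close> takes that of \<open>x\<close>, which starts no path, and \<open>f\<close>,
  if above \<open>D\<close>, takes \<open>2 .. D 1\<close>. All other letters behave
  generically.\<close>

lemma separated_adjacent:
  assumes x: "x = Suc m" "x \<le> D"
  shows "\<exists>f. separated (lab f)"
proof -
  obtain e f r0 where bX: "beyond X = [x..<Suc e] @ f # r0"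
    and ef: "x \<le> e" "e \<le> D" "f = 1 \<or> e = D \<and> D < f" "f \<in> set X"
    using beyond_X[OF x] by blast
  have D2: "2 \<le> D" using x m_ge by simp
  have fx: "f \<noteq> x" "f \<noteq> Suc e \<or> e = D" using ef x m_ge by auto
  let ?R = "adjacent_rule e f"
  have GX: "brk D (beyond X) = (e, f)" using bX brk_upt[OF ef(1,2) fx(2)] by simp
  \<comment> \<open>The letter \<open>h\<close> is masked, so its move does not affect the masked
    break.\<close>
  have Gm: "brk D (beyond (mtf h X)) = (e, f)" if "2 \<le> h" "h \<le> m" for h
  proof -
    have "brk D (beyond (pull [h] X)) = (e, f)"
    proof (rule brk_beyond_pull[of _ x])
      have "beyond ([h] @ filter (\<lambda>b. b \<notin> set [h]) X) = filter (\<lambda>b. b \<notin> set [h]) (beyond X)"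
        using that by (simp add: beyond_filter)
      also have "\<dots> = beyond X" using that unfolding beyond_def filter_filter by (auto intro!: filter_cong)
      finally show "prefix ([x..<Suc e] @ [f]) (beyond ([h] @ filter (\<lambda>b. b \<notin> set [h]) X))"
        using bX by (simp add: prefix_def del: upt_Suc)
    qed (use that ef fx x in auto)
    moreover have "pull [h] X = mtf h X" by (simp add: pull_def mtf_def)
    ultimately show ?thesis by simp
  qed
  \<comment> \<open>Among the vertices \<open>mtf k X\<close> with \<open>k \<noteq> x\<close>, only
    \<open>mtf m X\<close> starts with two consecutive letters. It shares the masked break
    \<open>(e, f)\<close> with \<open>X\<close>, so a different masked break excludes both.\<close>
  have run: "lab ?R V = a" if V: "V = [k..<Suc l] @ U" "2 \<le> k" "k \<le> l"
    and zx: "k = l \<Longrightarrow> hd U \<noteq> x" "k = l \<Longrightarrow> U \<noteq> []"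
    and G: "k = x \<or> k = m \<and> k < l \<Longrightarrow> brk D (beyond V) \<noteq> (e, f)" and val: "?R V = a"
    for V k l U a
  proof (rule lab_high[of V k])
    show "V = k # [Suc k..<Suc l] @ U" using V upt_snoc[of k l] by (simp del: upt_Suc)
    then have hd: "hd V = k" by simp
    show VX: "V \<noteq> X"
    proof
      assume "V = X"
      then show False using hd G GX unfolding x_def by auto
    qed
    show "k = a" if Vk: "V = mtf k X"
    proof -
      have "k \<noteq> x" using VX Vk by auto
      then obtain q where q: "V = k # x # q" using mtf_second[OF D2] Vk by blast
      have "k < l"
      proof (rule ccontr)
        assume "\<not> k < l"
        then have "k = l" using V by simp
        then have "V = k # U" using V by simp
        then show False using q zx \<open>k = l\<close> by (cases U) auto
      qed
      then have "V = k # Suc k # [Suc (Suc k)..<Suc l] @ U"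
        using V upt_snoc[of k l] upt_snoc[of "Suc k" l] by (simp del: upt_Suc)
      then have "k = m" using q x by simp
      then show ?thesis using G Gm[of k] Vk V \<open>k < l\<close> by auto
    qed
  qed (use V val in auto)
  have low: "lab ?R V = a" if V: "V = [k..<Suc l] @ z # r" "2 \<le> k" "k \<le> l" "l \<le> m" "z \<noteq> Suc l" "z \<noteq> x"
    and val: "(if z = 1 then if l = m then 1 else l else z) = a" for V k l z r a
  proof (rule run[of V k l])
    have "brk D V = (l, z)" using V m_le by (simp add: brk_upt del: upt_Suc)
    then show "?R V = a" using val V by (simp add: adjacent_rule_def)
  qed (use V x in auto)
  have high: "lab ?R V = a" if V: "V = [k..<Suc l] @ U" "2 \<le> k" "k \<le> l" "m < l" "l \<le> D"
    and zx: "k = l \<Longrightarrow> hd U \<noteq> x" "k = l \<Longrightarrow> U \<noteq> []"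
    and G: "brk D (beyond V) = (g, w)" "k \<le> x \<Longrightarrow> (g, w) \<noteq> (e, f)"
    and val: "(if w = x then g else if (g, w) = (e, f) then m
       else if w = 1 then if g = D then if e < D then D else f else if g = x then e else g else w) = a"
    for V k l U g w a
  proof (rule run[of V k l])
    have "m < fst (brk D V)" using brk_ge[OF V(3,5), of U] V by simp
    then show "?R V = a" using val G by (cases "brk D V") (simp add: adjacent_rule_def)
  qed (use V x zx G in auto)
  have one: "lab ?R V = a" if V: "V = 1 # [p..<Suc l] @ z # r" "3 \<le> p" "p \<le> l" "l \<le> D" "z \<noteq> Suc l \<or> l = D"
    and "p \<noteq> x" and val: "(if m < l then l else if z = x then m else z) = a"
    for V p l z r a
  proof (rule lab_run_one[OF V])
    have "hd V = 1" using V by simp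
    then show "V \<noteq> X" using x m_ge unfolding x_def by auto
    show "V \<noteq> mtf 1 X"
    proof
      assume V1: "V = mtf 1 X"
      have "V = 1 # p # [Suc p..<Suc l] @ z # r" using V upt_snoc[of p l] by (simp del: upt_Suc)
      moreover obtain q where "mtf 1 X = 1 # x # q" using mtf_second[OF D2, of 1] x m_ge by auto
      ultimately show False using V1 \<open>p \<noteq> x\<close> by simp
    qed
  qed (rule val)
  have split: "\<exists>w. route j w (lab ?R)"
    if j: "2 \<le> j" "j \<le> l" "l \<le> D" and L0: "lab ?R (mtf j X) = j"
      and z: "z > l" "prec X z (if j = l then 1 else l)"
      and lj: "l = m \<and> j < m \<or> l = j \<and> x < j \<and> j < e" for j l z
  proof -
    have al: "aligned l" using lj x by (auto intro: aligned_ge)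
    have l1: "lab ?R (pull ([k..<Suc l] @ [j]) X) = j" if k: "j < k" "k \<le> l" for k
    proof -
      have l: "l = m" using lj k by auto
      obtain r where r: "pull ([k..<Suc l] @ [j]) X = [k..<Suc l] @ j # r"
        using pull_run[of k l j "[]"] j k by auto
      show ?thesis by (rule low[OF r]) (use j k l x in auto)
    qed
    have l2: "lab ?R (pull (1 # [Suc j..<Suc l] @ [j]) X) = j"
    proof (cases "j = l")
      case False
      then have l: "l = m" "j < m" using lj j by auto
      obtain r where r: "pull (1 # [Suc j..<Suc l] @ [j]) X = 1 # [Suc j..<Suc l] @ j # r"
        using pull_run_one[of "Suc j" l j "[]"] j l by auto
      show ?thesis by (rule one[OF r]) (use j l x in auto)
    next
      case True
      then have l: "l = j" "x < j" "j < e" using lj x by auto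
      have "\<exists>r. pull [1, j] X = [1, j] @ x # r"
        using l x m_ge ef by (intro pull_snoc_x) auto
      then obtain r where r: "pull (1 # [Suc j..<Suc l] @ [j]) X = 1 # [j..<Suc j] @ x # r"
        using l by auto
      show ?thesis by (rule one[OF r]) (use j l x ef m_ge in auto)
    qed
    have l3: "lab ?R (pull ([k..<Suc j] @ 1 # [Suc j..<Suc l]) X) = j" if k: "2 \<le> k" "k \<le> j" for k
    proof -
      let ?s = "[k..<Suc j] @ 1 # [Suc j..<Suc l]"
      obtain r where r: "pull ?s X = [k..<Suc j] @ 1 # r"
        using pull_run[of k j 1 "[Suc j..<Suc l]"] j k by auto
      show ?thesis
      proof (cases "l = m")
        case True
        then show ?thesis by (intro low[OF r]) (use j k lj x in auto)
      next
        case False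
        then have l: "l = j" "x < j" "j < e" using lj by auto
        have "brk D (beyond (pull ?s X)) = (j, 1)"
          by (rule brk_beyond_pull[of _ "max k x"])
            (use l k j x in \<open>auto simp: beyond_upt prefix_def simp del: upt_Suc\<close>)
        then show ?thesis by (intro high[OF r]) (use l k j x ef m_ge in auto)
      qed
    qed
    show ?thesis
      by (rule exI, rule route_split[OF j al z L0 l1 l2 l3])
  qed
  have "\<exists>w. route a w (lab ?R)" if a: "a \<in> {1..\<Delta> + 1}" "a \<noteq> x" "mtf a X \<noteq> [1..<Suc D]" for a
  proof -
    note L0 = lab_mtf[OF a(2,3), of ?R]
    have m1: "2 \<le> m" if "a = 1"
    proof (rule ccontr)
      assume "\<not> 2 \<le> m"
      then have "m = 1" using m_ge by simp
      then have "mtf 1 (pull [] X) = [1..<Suc D]"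
        using mtf_1_pull[of "[]" 1] aligned_m D by simp
      moreover have "pull [] X = X" by (simp add: pull_def)
      ultimately show False using a(3) that by simp
    qed
    consider "D < a" "a \<noteq> f" | "D < a" "a = f" | "a = 1" | "2 \<le> a" "a < m" | "2 \<le> a" "a = m"
      | "x < a" "a < e" | "x < a" "a = e" | "e < a" "a \<le> D"
      using a(1,2) x by force
    then show ?thesis
    proof cases
      case 1
      have "lab ?R (pull ([k..<Suc D] @ [a]) X) = a" if k: "2 \<le> k" "k \<le> D" for k
      proof -
        obtain r where r: "pull ([k..<Suc D] @ [a]) X = [k..<Suc D] @ a # r"
          using pull_run[of k D a "[]"] k by auto
        have "brk D (beyond (pull ([k..<Suc D] @ [a]) X)) = (D, a)"
          by (rule brk_beyond_pull[of _ "max k x"])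
            (use 1 k x m_le in \<open>auto simp: beyond_upt prefix_def simp del: upt_Suc\<close>)
        then show ?thesis by (intro high[OF r]) (use 1 k x in auto)
      qed
      then show ?thesis using route_below[of a D] a 1 L0 D2 by auto
    next
      case 2
      then have f: "f \<noteq> 1" "e = D" "D < f" using ef D by auto
      have l1: "lab ?R (pull [1, a] X) = a"
      proof -
        obtain r where r: "pull [1, a] X = 1 # a # r" using pull_prefix[of "[1, a]" "[]"] D2 by auto
        obtain q where q: "mtf 1 X = 1 # x # q" using mtf_second[OF D2, of 1] x m_ge by auto
        have "X \<noteq> 1 # a # r" using x m_ge unfolding x_def by (metis list.sel(1) One_nat_def Suc_inject not_one_le_zero)
        \<comment> \<open>No run continues from a letter above \<open>D\<close>, so the break is at
          \<open>a\<close>; since \<open>a > m\<close>, it is also the label.\<close>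
        moreover have "\<exists>v. brk D (a # r) = (a, v)" using 2(1) by (cases r) auto
        then obtain v where "brk D (a # r) = (a, v)" ..
        ultimately show ?thesis unfolding r
          by (intro lab_one[OF refl refl]) (use 2 x D2 q m_le in auto)
      qed
      have l2: "lab ?R (pull ([k..<Suc D] @ [1, a]) X) = a" if k: "2 \<le> k" "k \<le> D" for k
      proof -
        obtain r where r: "pull ([k..<Suc D] @ [1, a]) X = [k..<Suc D] @ 1 # r"
          using pull_run[of k D 1 "[a]"] k by auto
        have "brk D (beyond (pull ([k..<Suc D] @ [1, a]) X)) = (D, 1)"
          by (rule brk_beyond_pull[of _ "max k x"])
            (use 2 k x in \<open>auto simp: beyond_upt prefix_def simp del: upt_Suc\<close>)
        then show ?thesis by (intro high[OF r]) (use 2 k x f m_ge in auto)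
      qed
      show ?thesis by (rule exI, rule route_outside[OF _ _ D2 L0 l1 l2]) (use 2 a in auto)
    next
      case 3
      have "lab ?R (pull ([k..<Suc m] @ [a]) X) = a" if k: "2 \<le> k" "k \<le> m" for k
      proof -
        obtain r where r: "pull ([k..<Suc m] @ [a]) X = [k..<Suc m] @ a # r"
          using pull_run[of k m a "[]"] k m_le by auto
        show ?thesis by (rule low[OF r]) (use 3 k x m_le in auto)
      qed
      then show ?thesis using route_below[of a m] a 3 L0 m1 m_le aligned_m by auto
    next
      case 4
      obtain z where z: "z > m" "prec X z m" using ex_prec_m by blast
      then show ?thesis using split[of a m z] 4 m_le L0 by auto
    next
      case 5
      have "lab ?R (pull [k..<Suc a] X) = a" if k: "2 \<le> k" "k < a" for k
      proof -
        have "\<exists>r. pull [k..<Suc a] X = [k..<Suc a] @ x # r"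
          by (rule pull_snoc_x) (use k 5 x in \<open>auto simp del: upt_Suc\<close>)
        \<comment> \<open>As \<open>x = m + 1\<close> continues the run \<open>k .. m\<close>, the
          ordinary break lies beyond \<open>m\<close> and the masked break \<open>(e, f)\<close>
          yields the label.\<close>
        then obtain r where r: "pull [k..<Suc a] X = [k..<Suc x] @ r" using 5 x k by auto
        have "brk D (beyond (pull [k..<Suc a] X)) = (e, f)"
        proof (rule brk_beyond_pull[of _ x])
          have "beyond [k..<Suc a] = []" using k 5 by (simp add: beyond_upt del: upt_Suc)
          moreover have "filter (\<lambda>b. b \<notin> set [k..<Suc a]) (beyond X) = beyond X"
            using k 5 unfolding beyond_def filter_filter by (auto intro!: filter_cong simp del: upt_Suc)
          ultimately show "prefix ([x..<Suc e] @ [f]) (beyond ([k..<Suc a] @ filter (\<lambda>b. b \<notin> set [k..<Suc a]) X))"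
            using bX by (simp add: beyond_filter prefix_def del: upt_Suc)
        qed (use k ef fx x in \<open>auto simp del: upt_Suc\<close>)
        moreover have "x \<le> fst (brk D (pull [k..<Suc a] X))" unfolding r
          by (rule brk_ge) (use k 5 x in auto)
        ultimately have "?R (pull [k..<Suc a] X) = a"
          using 5 x fx by (cases "brk D (pull [k..<Suc a] X)") (simp add: adjacent_rule_def del: upt_Suc)
        then show ?thesis by (intro run[OF r]) (use k 5 x in auto)
      qed
      then show ?thesis using route_within[of a] 5 m_le aligned_m L0 by blast
    next
      case 6
      \<comment> \<open>\<open>a + 1 \<le> e\<close> belongs to the initial run of
        \<open>beyond X\<close>, and 1 can only come after that run.\<close>
      have "prec (beyond X) (Suc a) 1"
        unfolding bX prec_append using 6 x m_ge by (intro disjI1 prec_notin) auto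
      then have "prec X (Suc a) 1" unfolding beyond_def by (subst (asm) prec_filter) (use 6 x in auto)
      then show ?thesis using split[of a a "Suc a"] 6 x ef L0 m_ge by auto
    next
      case 7
      have l1: "lab ?R (pull [k..<Suc a] X) = a" if k: "x < k" "k < a" for k
      proof -
        have "\<exists>r. pull [k..<Suc a] X = [k..<Suc a] @ x # r"
          by (rule pull_snoc_x) (use k 7 x ef m_ge in \<open>auto simp del: upt_Suc\<close>)
        then obtain r where r: "pull [k..<Suc a] X = [k..<Suc a] @ x # r" by blast
        have "brk D (beyond (pull [k..<Suc a] X)) = (a, x)"
          by (rule brk_beyond_pull[of _ k])
            (use 7 k x ef m_ge in \<open>auto simp: beyond_upt prefix_def filter_X simp del: upt_Suc\<close>)
        then show ?thesis by (intro high[OF r]) (use 7 k x ef m_ge in auto)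
      qed
      have l2: "lab ?R (pull (1 # [Suc x..<Suc a]) X) = a"
      proof -
        have "\<exists>r. pull (1 # [Suc x..<Suc a]) X = (1 # [Suc x..<Suc a]) @ x # r"
          by (rule pull_snoc_x) (use 7 x ef m_ge in \<open>auto simp del: upt_Suc\<close>)
        then obtain r where r: "pull (1 # [Suc x..<Suc a]) X = 1 # [Suc x..<Suc a] @ x # r" by auto
        show ?thesis by (rule one[OF r]) (use 7 x ef m_ge in auto)
      qed
      have l3: "lab ?R (pull ([k..<Suc x] @ 1 # [Suc x..<Suc a]) X) = a" if k: "2 \<le> k" "k \<le> x" for k
      proof -
        let ?s = "[k..<Suc x] @ 1 # [Suc x..<Suc a]"
        obtain r where r: "pull ?s X = [k..<Suc x] @ 1 # r"
          using pull_run[of k x 1 "[Suc x..<Suc a]"] k x by auto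
        have "brk D (beyond (pull ?s X)) = (x, 1)"
          by (rule brk_beyond_pull[of _ x])
            (use 7 k x m_ge in \<open>auto simp: beyond_upt prefix_def simp del: upt_Suc\<close>)
        then show ?thesis by (intro high[OF r]) (use 7 k x ef m_ge in auto)
      qed
      show ?thesis
        by (rule exI, rule route_shifted[OF _ _ _ _ L0 l1 l2 l3])
          (use 7 x ef m_ge in \<open>auto intro: aligned_ge\<close>)
    next
      case 8
      then have f: "f = 1" "e < D" using ef by auto
      have "lab ?R (pull [k..<Suc a] X) = a" if k: "2 \<le> k" "k < a" for k
      proof -
        let ?s = "[k..<Suc a]"
        have "length ?s \<le> D" using k 8 by (auto simp del: upt_Suc)
        then obtain r where r: "pull ?s X = [k..<Suc a] @ r" using pull_prefix[of ?s "[]"] by auto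
        \<comment> \<open>For \<open>k \<le> x\<close> all of \<open>x .. e\<close> has been moved,
          and the next visible letter is \<open>f = 1\<close>; for \<open>k > x\<close> the first
          letter \<open>x\<close> is still unmoved.\<close>
        have "brk D (beyond (pull ?s X)) = (a, if k \<le> x then 1 else x)"
        proof (rule brk_beyond_pull[of _ "max k x"])
          have b: "beyond ?s = [max k x..<Suc a]" using k x by (simp add: beyond_upt del: upt_Suc)
          show "prefix ([max k x..<Suc a] @ [if k \<le> x then 1 else x]) (beyond (?s @ filter (\<lambda>b. b \<notin> set ?s) X))"
          proof (cases "k \<le> x")
            case True
            then have "filter (\<lambda>b. b \<notin> set ?s) (beyond X) = 1 # filter (\<lambda>b. b \<notin> set ?s) r0"
              unfolding bX f using k 8 by (auto simp: filter_empty_conv simp del: upt_Suc)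
            then show ?thesis using True b by (simp add: beyond_filter prefix_def del: upt_Suc)
          next
            case False
            then show ?thesis using b x by (simp add: filter_X prefix_def del: upt_Suc)
          qed
        qed (use k 8 x ef in \<open>auto simp del: upt_Suc\<close>)
        then show ?thesis by (intro high[OF r]) (use k 8 x ef f in \<open>auto split: if_splits\<close>)
      qed
      then show ?thesis using route_within[of a] 8 x ef L0 aligned_ge by auto
    qed
  qed
  then show ?thesis using separatedI by blast
qed

theorem ex_separated: "\<exists>L. separated L"
proof (cases rule: x_cases)
  case 1
  then show ?thesis using separated_low by blast
next
  case 2
  then show ?thesis using separated_middle by blast
next
  case 3
  then show ?thesis using separated_adjacent by blast
qed

end

section \<open>Shortest paths\<close>

lemma cycle_prefix_simps [simp]:
  "pverts (cycle_prefix_digraph \<Delta> D) = cp_verts \<Delta> D"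
  by (simp add: cycle_prefix_digraph_def)

lemma cp_verts_hd: "X \<in> cp_verts \<Delta> D \<Longrightarrow> 1 \<le> D \<Longrightarrow> X \<noteq> [] \<and> hd X \<in> {1..\<Delta> + 1}"
  by (cases X) (auto simp: cp_verts_def)

lemma mtf_in_verts:
  assumes "X \<in> cp_verts \<Delta> D" "1 \<le> D" "a \<in> {1..\<Delta> + 1}"
  shows "mtf a X \<in> cp_verts \<Delta> D"
proof -
  have "X \<noteq> []" using assms by (auto simp: cp_verts_def)
  then show ?thesis using assms set_mtf[of a X] by (auto simp: cp_verts_def)
qed

lemma mtfs_in_verts:
  "X \<in> cp_verts \<Delta> D \<Longrightarrow> 1 \<le> D \<Longrightarrow> set w \<subseteq> {1..\<Delta> + 1} \<Longrightarrow> foldr mtf w X \<in> cp_verts \<Delta> D"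
  by (induction w) (auto intro: mtf_in_verts)

lemma mtf_nth:
  assumes "distinct X" "i < length X"
  shows "mtf (X ! i) X = X ! i # take i X @ drop (Suc i) X"
proof -
  have X: "X = take i X @ X ! i # drop (Suc i) X" using assms(2) by (rule id_take_nth_drop)
  have d: "X ! i \<notin> set (take i X)" "X ! i \<notin> set (drop (Suc i) X)"
    using assms(1) by (subst (asm) X, auto)+
  have "filter (\<lambda>b. b \<noteq> X ! i) X = take i X @ drop (Suc i) X"
    by (subst X) (simp add: filter_neq_id[OF d(1)] filter_neq_id[OF d(2)])
  then show ?thesis using assms(2) by (simp add: mtf_def)
qed

lemma mtf_notin: "a \<notin> set X \<Longrightarrow> X \<noteq> [] \<Longrightarrow> mtf a X = a # butlast X"
  by (cases "length X") (auto simp: mtf_def filter_neq_id butlast_conv_take)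

text \<open>Rotations move a letter of \<open>X\<close>, shifts a new one;
  \<open>a \<noteq> hd X\<close> excludes the move that changes nothing.\<close>

lemma arcs_iff:
  assumes "1 \<le> D"
  shows "(X, Z) \<in> parcs (cycle_prefix_digraph \<Delta> D) \<longleftrightarrow>
    X \<in> cp_verts \<Delta> D \<and> (\<exists>a \<in> {1..\<Delta> + 1}. a \<noteq> hd X \<and> Z = mtf a X)"
proof (cases "X \<in> cp_verts \<Delta> D")
  case True
  then have X: "length X = D" "distinct X" "set X \<subseteq> {1..\<Delta> + 1}" "X \<noteq> []"
    using assms by (auto simp: cp_verts_def)
  have rot: "Z \<in> rotations X \<longleftrightarrow> (\<exists>a \<in> set X. a \<noteq> hd X \<and> Z = mtf a X)"
  proof
    assume "Z \<in> rotations X"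
    then obtain k where k: "2 \<le> k" "k \<le> length X" "Z = X ! (k - 1) # take (k - 1) X @ drop k X"
      by (auto simp: rotations_def)
    moreover from k have "X ! (k - 1) \<noteq> hd X"
      using X by (simp add: hd_conv_nth nth_eq_iff_index_eq)
    ultimately show "\<exists>a \<in> set X. a \<noteq> hd X \<and> Z = mtf a X"
      using mtf_nth[OF X(2), of "k - 1"] by (intro bexI[of _ "X ! (k - 1)"]) auto
  next
    assume "\<exists>a \<in> set X. a \<noteq> hd X \<and> Z = mtf a X"
    then obtain i where i: "i < length X" "X ! i \<noteq> hd X" "Z = mtf (X ! i) X"
      by (auto simp: in_set_conv_nth)
    then have "i \<noteq> 0" using X by (metis hd_conv_nth)
    then show "Z \<in> rotations X"
      using i mtf_nth[OF X(2) i(1)] unfolding rotations_def by (auto intro!: exI[of _ "Suc i"])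
  qed
  have sh: "Z \<in> shifts \<Delta> X \<longleftrightarrow> (\<exists>a \<in> {1..\<Delta> + 1} - set X. Z = mtf a X)"
    using X(4) by (auto simp: shifts_def mtf_notin)
  have hd: "hd X \<in> set X" using X(4) by simp
  have "Z \<in> rotations X \<union> shifts \<Delta> X \<longleftrightarrow> (\<exists>a \<in> {1..\<Delta> + 1}. a \<noteq> hd X \<and> Z = mtf a X)"
  proof
    assume "Z \<in> rotations X \<union> shifts \<Delta> X"
    then show "\<exists>a \<in> {1..\<Delta> + 1}. a \<noteq> hd X \<and> Z = mtf a X"
    proof
      assume "Z \<in> rotations X"
      then obtain a where "a \<in> set X" "a \<noteq> hd X" "Z = mtf a X" using rot by blast
      then show ?thesis using X(3) by (intro bexI[of _ a]) auto
    next
      assume "Z \<in> shifts \<Delta> X"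
      then obtain a where "a \<in> {1..\<Delta> + 1} - set X" "Z = mtf a X" using sh by blast
      then show ?thesis using hd by (intro bexI[of _ a]) auto
    qed
  next
    assume "\<exists>a \<in> {1..\<Delta> + 1}. a \<noteq> hd X \<and> Z = mtf a X"
    then obtain a where a: "a \<in> {1..\<Delta> + 1}" "a \<noteq> hd X" "Z = mtf a X" by blast
    show "Z \<in> rotations X \<union> shifts \<Delta> X"
    proof (cases "a \<in> set X")
      case True
      then have "Z \<in> rotations X" unfolding rot using a(2,3) by (intro bexI[of _ a] conjI)
      then show ?thesis ..
    next
      case False
      then have "Z \<in> shifts \<Delta> X" unfolding sh using a(1,3) by (intro bexI[of _ a]) auto
      then show ?thesis ..
    qed
  qed
  then show ?thesis using True by (simp add: cycle_prefix_digraph_def)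
qed (simp add: cycle_prefix_digraph_def)

lemma out_nbrs_eq:
  assumes "1 \<le> D" "X \<in> cp_verts \<Delta> D"
  shows "out_nbrs (cycle_prefix_digraph \<Delta> D) X = (\<lambda>a. mtf a X) ` ({1..\<Delta> + 1} - {hd X})"
  using arcs_iff[OF assms(1)] assms(2) unfolding out_nbrs_def by auto

lemma in_nbrs_eq:
  assumes "1 \<le> D" "Y \<in> cp_verts \<Delta> D"
  shows "in_nbrs (cycle_prefix_digraph \<Delta> D) Y = {W \<in> cp_verts \<Delta> D. hd W \<noteq> hd Y \<and> mtf (hd Y) W = Y}"
proof -
  have Y: "Y \<noteq> []" "hd Y \<in> {1..\<Delta> + 1}" using cp_verts_hd assms by blast+
  have "hd (mtf a W) = a" if "W \<in> cp_verts \<Delta> D" for a W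
    using that assms by (intro hd_mtf) (auto simp: cp_verts_def)
  then have "(\<exists>a \<in> {1..\<Delta> + 1}. a \<noteq> hd W \<and> Y = mtf a W) \<longleftrightarrow> hd W \<noteq> hd Y \<and> mtf (hd Y) W = Y"
    if "W \<in> cp_verts \<Delta> D" for W
    using that Y(2) by metis
  then show ?thesis unfolding in_nbrs_def using arcs_iff[OF assms(1)] by auto
qed

lemma card_out_nbrs:
  assumes "1 \<le> D" "X \<in> cp_verts \<Delta> D"
  shows "card (out_nbrs (cycle_prefix_digraph \<Delta> D) X) = \<Delta>"
proof -
  have X: "X \<noteq> []" "hd X \<in> {1..\<Delta> + 1}" using cp_verts_hd assms by blast+
  have "inj_on (\<lambda>a. mtf a X) ({1..\<Delta> + 1} - {hd X})"
    by (intro inj_onI) (metis X(1) hd_mtf)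
  then show ?thesis using X(2) by (simp add: out_nbrs_eq[OF assms] card_image)
qed

section \<open>Walks as words of letters\<close>

primrec trail :: "'a list \<Rightarrow> 'a list \<Rightarrow> 'a list list" where
  "trail [] Z = [Z]"
| "trail (a # w) Z = trail w Z @ [foldr mtf (a # w) Z]"

lemma trail_neq_Nil [simp]: "trail w Z \<noteq> []"
  by (cases w) auto

lemma length_trail [simp]: "length (trail w Z) = Suc (length w)"
  by (induction w) auto

lemma hd_trail [simp]: "hd (trail w Z) = Z"
  by (induction w) auto

lemma last_trail [simp]: "last (trail w Z) = foldr mtf w Z"
  by (cases w) auto

lemma set_trail: "set (trail w Z) = {foldr mtf s Z | s. suffix s w}"
proof (induction w)
  case (Cons a w)
  have "{foldr mtf s Z |s. suffix s (a # w)} = insert (foldr mtf (a # w) Z) {foldr mtf s Z |s. suffix s w}"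
    unfolding suffix_Cons by blast
  then show ?case using Cons by simp
qed simp

lemma vwalk_snoc:
  assumes "p \<noteq> []"
  shows "vwalk (p @ [v]) G \<longleftrightarrow> vwalk p G \<and> v \<in> verts G \<and> (last p, v) \<in> arcs_ends G"
  using assms by (auto simp: vwalk_def set_vwalk_arcs_snoc)

lemma vwalk_imp_trail:
  assumes "1 \<le> D" "vwalk p (with_proj (cycle_prefix_digraph \<Delta> D))"
  shows "\<exists>w. set w \<subseteq> {1..\<Delta> + 1} \<and> p = trail w (hd p)"
  using assms(2)
proof (induction p rule: rev_induct)
  case Nil
  then show ?case by (auto simp: vwalk_def)
next
  case (snoc v p)
  show ?case
  proof (cases "p = []")
    case True
    then show ?thesis by (intro exI[of _ "[]"]) auto
  next
    case False
    then have p: "vwalk p (with_proj (cycle_prefix_digraph \<Delta> D))"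
      "(last p, v) \<in> parcs (cycle_prefix_digraph \<Delta> D)"
      using snoc.prems by (auto simp: vwalk_snoc)
    then obtain w where w: "set w \<subseteq> {1..\<Delta> + 1}" "p = trail w (hd p)" using snoc.IH by blast
    obtain a where a: "a \<in> {1..\<Delta> + 1}" "v = mtf a (last p)"
      using p(2) arcs_iff[OF assms(1)] by blast
    have "last p = foldr mtf w (hd p)" using w(2) by (metis last_trail)
    then have "p @ [v] = trail (a # w) (hd (p @ [v]))" using w(2) a(2) False by simp
    then show ?thesis using w(1) a(1) by (intro exI[of _ "a # w"]) auto
  qed
qed

text \<open>The condition on suffixes says that no step moves the letter already in front, so that
  every step is an arc.\<close>

lemma vwalk_trail:
  assumes "1 \<le> D" "Z \<in> cp_verts \<Delta> D" "set w \<subseteq> {1..\<Delta> + 1}"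
    and "\<And>a s. suffix (a # s) w \<Longrightarrow> a \<noteq> hd (foldr mtf s Z)"
  shows "vwalk (trail w Z) (with_proj (cycle_prefix_digraph \<Delta> D))"
  using assms(3,4)
proof (induction w)
  case Nil
  then show ?case using assms(2) by (simp add: vwalk_def)
next
  case (Cons a w)
  have v: "foldr mtf w Z \<in> cp_verts \<Delta> D" using Cons.prems assms by (intro mtfs_in_verts) auto
  have "suffix (b # s) (a # w)" if "suffix (b # s) w" for b s
    using that by (simp add: suffix_Cons)
  then have "vwalk (trail w Z) (with_proj (cycle_prefix_digraph \<Delta> D))" using Cons by simp
  moreover have "(foldr mtf w Z, mtf a (foldr mtf w Z)) \<in> parcs (cycle_prefix_digraph \<Delta> D)"
    unfolding arcs_iff[OF assms(1)] using v Cons.prems(1) Cons.prems(2)[of a w] by auto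
  ultimately show ?case using v mtf_in_verts[OF v assms(1), of a] Cons.prems(1)
    by (simp add: vwalk_snoc)
qed

text \<open>If a letter is moved several times, only its final move matters and the earlier ones can
  be struck out.\<close>

lemma ex_distinct_word:
  assumes "distinct Z" "Z \<noteq> []"
  shows "\<exists>r. distinct r \<and> foldr mtf r Z = foldr mtf w Z \<and> (r = w \<or> length r < length w)"
proof (induction w)
  case (Cons a w)
  then obtain r where r: "distinct r" "foldr mtf r Z = foldr mtf w Z" "r = w \<or> length r < length w"
    by blast
  show ?case
  proof (cases "a \<in> set r")
    case False
    then show ?thesis using r by (intro exI[of _ "a # r"]) auto
  next
    case True
    let ?r = "filter (\<lambda>b. b \<noteq> a) r"
    have "mtf a (pull ?r Z) = mtf a (pull r Z)"
    proof -
      have "insert a (set ?r) = insert a (set r)" by auto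
      then show ?thesis using r(1) assms by (simp add: mtf_pull)
    qed
    then have "foldr mtf (a # ?r) Z = foldr mtf (a # w) Z"
      using r mtfs_pull[OF assms] by (metis distinct_filter foldr_Cons o_apply)
    moreover have "length ?r < length r" using True by (simp add: length_filter_less)
    ultimately show ?thesis using r by (intro exI[of _ "a # ?r"]) auto
  qed
qed auto

text \<open>Replace \<open>w'\<close> by a word \<open>r\<close> without repetitions. If
  \<open>r\<close> is no longer than \<open>w\<close>, it is a beginning of \<open>w\<close>, since
  both stand at the front of the same vertex. The rest of \<open>w\<close> would then be the first
  letters of \<open>Z\<close> outside \<open>r\<close>; up to \<open>last w\<close> these include
  \<open>z\<close>, which is not in \<open>w\<close>.\<close>

lemma shortest_word:
  assumes Z: "distinct Z" "Z \<noteq> []"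
    and w: "distinct w" "length w \<le> length Z" "w = [] \<or> (\<exists>z. z \<notin> set w \<and> prec Z z (last w))"
    and eq: "foldr mtf w' Z = foldr mtf w Z"
  shows "w' = w \<or> length w < length w'"
proof -
  obtain r where r: "distinct r" "foldr mtf r Z = foldr mtf w' Z" "r = w' \<or> length r < length w'"
    using ex_distinct_word[OF Z] by blast
  show ?thesis
  proof (cases "length r \<le> length w")
    case True
    have e: "pull r Z = pull w Z" using r eq w(1) mtfs_pull[OF Z] by metis
    have "r = take (length r) (pull r Z)" using True w(2) by (simp add: pull_def)
    also have "\<dots> = take (length r) w" unfolding e using True w(2) by (simp add: pull_def)
    finally obtain t where t: "w = r @ t" by (metis append_take_drop_id)
    have "t = []"
    proof (rule ccontr)
      assume tn: "t \<noteq> []"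
      then obtain z where z: "z \<notin> set w" "prec Z z (last w)" using w(3) t by auto
      have l: "last w \<in> set t" "last w \<notin> set r" using tn t w(1) by (auto simp: disjoint_iff)
      have "take (length w) (pull r Z) = take (length w) (pull w Z)" using e by simp
      then have "take (length w) (r @ filter (\<lambda>b. b \<notin> set r) Z) = w"
        using w(2) unfolding pull_def take_take by (simp add: min_absorb1)
      then have "take (length t) (filter (\<lambda>b. b \<notin> set r) Z) = t" using t by simp
      then obtain u where u: "filter (\<lambda>b. b \<notin> set r) Z = t @ u" by (metis append_take_drop_id)
      have "prec (filter (\<lambda>b. b \<notin> set r) Z) z (last w)"
        using z t l by (subst prec_filter) auto
      then have "prec t z (last w)" using l unfolding u prec_append by blast
      then show False using z t prec_in_set by fastforce
    qed
    then show ?thesis using t r(3) by auto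
  next
    case False
    then show ?thesis using r(3) by auto
  qed
qed

lemma trail_shortest:
  fixes \<Delta> D :: nat
  defines "G \<equiv> cycle_prefix_digraph \<Delta> D"
  assumes D: "1 \<le> D" and Z: "Z \<in> cp_verts \<Delta> D"
    and w: "distinct w" "length w \<le> D" "set w \<subseteq> {1..\<Delta> + 1}"
      "w = [] \<or> (\<exists>z. z \<notin> set w \<and> prec Z z (last w))"
  shows "is_shortest_path G Z (trail w Z) (foldr mtf w Z)"
    and "shortest_path G Z (foldr mtf w Z) = trail w Z"
proof -
  have Z': "distinct Z" "Z \<noteq> []" "length Z = D" using Z D by (auto simp: cp_verts_def)
  have walk: "vwalk (trail w Z) (with_proj G)" unfolding G_def
  proof (rule vwalk_trail[OF D Z w(3)])
    fix a s assume s: "suffix (a # s) w"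
    show "a \<noteq> hd (foldr mtf s Z)"
    proof (cases s)
      case Nil
      then have "a = last w" "w \<noteq> []" using s by (auto simp: suffix_def)
      then obtain z where "prec Z z a" using w(4) by auto
      then show ?thesis using Nil Z'(2) by (cases Z) auto
    next
      case (Cons b s')
      have "foldr mtf s' Z \<noteq> []" using mtfs_in_verts[OF Z D, of s'] s Cons w(3) D
        by (force simp: cp_verts_def suffix_def)
      moreover have "a \<noteq> b" using s Cons w(1) by (auto simp: suffix_def)
      ultimately show ?thesis using Cons by simp
    qed
  qed
  have min: "p = trail w Z \<or> length (trail w Z) < length p"
    if p: "vwalk p (with_proj G)" "hd p = Z" "last p = foldr mtf w Z" for p
  proof -
    obtain w' where w': "p = trail w' Z" using vwalk_imp_trail[OF D] p unfolding G_def by blast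
    then have "foldr mtf w' Z = foldr mtf w Z" using p(3) by simp
    then show ?thesis using shortest_word[OF Z'(1,2) w(1) _ w(4)] w(2) Z'(3) w' by auto
  qed
  have "distinct (trail w Z)"
  proof (rule ccontr)
    \<comment> \<open>A walk that repeats a vertex could be shortened to a path with the same ends,
      against \<open>min\<close>.\<close>
    assume nd: "\<not> distinct (trail w Z)"
    let ?q = "vwalk_to_vpath (trail w Z)"
    have q: "vpath ?q (with_proj G)" by (rule vwalk_to_vpath_vpath[OF walk])
    have "length ?q = card (set ?q)" using q by (simp add: vpath_def distinct_card)
    also have "\<dots> \<le> card (set (trail w Z))" using vwalk_to_vpath_subset by (intro card_mono) auto
    also have "\<dots> < length (trail w Z)" using nd card_distinct card_length le_neq_implies_less by blast
    finally have "length ?q < length (trail w Z)" .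
    moreover have "?q = trail w Z \<or> length (trail w Z) < length ?q"
      using q by (intro min) (auto simp: vpath_def vwalk_to_vpath_hd vwalk_to_vpath_last)
    ultimately show False by auto
  qed
  then have path: "path_from_to G Z (trail w Z) (foldr mtf w Z)"
    using walk by (simp add: path_from_to_def vpath_def)
  have uniq: "q = trail w Z \<or> length (trail w Z) < length q" if "path_from_to G Z q (foldr mtf w Z)" for q
    using that min by (auto simp: path_from_to_def vpath_def)
  show sp: "is_shortest_path G Z (trail w Z) (foldr mtf w Z)"
    using path uniq unfolding is_shortest_path_def by fastforce
  show "shortest_path G Z (foldr mtf w Z) = trail w Z"
    unfolding shortest_path_def
  proof (rule the_equality, rule sp)
    fix q assume q: "is_shortest_path G Z q (foldr mtf w Z)"
    then have "vwalk_length q \<le> vwalk_length (trail w Z)" "q \<noteq> []" using path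
      by (auto simp: is_shortest_path_def path_from_to_def vpath_def vwalk_def)
    then have "length q \<le> length (trail w Z)" by (cases q) auto
    then show "q = trail w Z" using uniq[of q] q by (auto simp: is_shortest_path_def)
  qed
qed

section \<open>Arbitrary end vertices\<close>

lemma mtf_map: "inj \<pi> \<Longrightarrow> mtf (\<pi> a) (map \<pi> X) = map \<pi> (mtf a X)"
  by (cases "length X") (simp_all add: mtf_def take_map filter_map o_def inj_eq)

lemma foldr_mtf_map: "inj \<pi> \<Longrightarrow> foldr mtf (map \<pi> w) (map \<pi> X) = map \<pi> (foldr mtf w X)"
  by (induction w) (auto simp: mtf_map)

lemma prec_map: "inj \<pi> \<Longrightarrow> prec (map \<pi> X) (\<pi> a) (\<pi> b) \<longleftrightarrow> prec X a b"
  by (induction X) (auto simp: inj_eq)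

lemma ex_relabelling:
  assumes "Y \<in> cp_verts \<Delta> D" "D \<le> \<Delta>"
  shows "\<exists>\<pi>. bij \<pi> \<and> \<pi> ` {1..\<Delta> + 1} = {1..\<Delta> + 1} \<and> \<pi> 0 = 0 \<and> map \<pi> Y = [1..<Suc D]"
proof -
  have Y: "length Y = D" "distinct Y" "set Y \<subseteq> {1..\<Delta> + 1}" using assms by (auto simp: cp_verts_def)
  let ?A = "{1..\<Delta> + 1}"
  let ?f = "\<lambda>c. Suc (inv_into {..<D} ((!) Y) c)"
  have nth: "bij_betw ((!) Y) {..<D} (set Y)" using Y(1,2) by (intro bij_betw_nth) auto
  have S: "bij_betw Suc {..<D} {1..D}"
    by (rule bij_betwI[where g = "\<lambda>i. i - 1"]) auto
  have f: "bij_betw ?f (set Y) {1..D}"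
    using bij_betw_trans[OF bij_betw_inv_into[OF nth] S] by (simp only: o_def)
  have "card (?A - set Y) = card (?A - {1..D})"
    using Y assms(2) by (simp add: card_Diff_subset distinct_card)
  then obtain g where g: "bij_betw g (?A - set Y) (?A - {1..D})"
    using finite_same_card_bij[of "?A - set Y" "?A - {1..D}"] by auto
  \<comment> \<open>Three pieces make a bijection of all numbers, so that \<open>map\<close> is
    injective. Everything outside the alphabet is fixed, in particular 0, the label of the end
    vertices.\<close>
  let ?p = "\<lambda>c. if c \<in> set Y then ?f c else if c \<in> ?A then g c else c"
  have b1: "bij_betw ?p (set Y) {1..D}" using f by (rule bij_betw_cong[THEN iffD1, rotated]) auto
  have b2: "bij_betw ?p (?A - set Y) (?A - {1..D})" using g by (rule bij_betw_cong[THEN iffD1, rotated]) auto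
  have b3: "bij_betw ?p (- ?A) (- ?A)"
    using Y(3) by (intro bij_betw_cong[THEN iffD1, OF _ bij_betw_id]) auto
  have "bij_betw ?p (set Y \<union> (?A - set Y)) ({1..D} \<union> (?A - {1..D}))"
    by (rule bij_betw_combine[OF b1 b2]) auto
  moreover have "set Y \<union> (?A - set Y) = ?A" "{1..D} \<union> (?A - {1..D}) = ?A" using Y(3) assms(2) by auto
  ultimately have b4: "bij_betw ?p ?A ?A" by simp
  have "bij_betw ?p (?A \<union> - ?A) (?A \<union> - ?A)" by (rule bij_betw_combine[OF b4 b3]) auto
  then have "bij ?p" by simp
  moreover have "?p ` ?A = ?A" using b4 by (simp add: bij_betw_def)
  moreover have "?p 0 = 0" using Y(3) by auto
  moreover have "map ?p Y = [1..<Suc D]"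
  proof (rule nth_equalityI)
    fix i assume "i < length (map ?p Y)"
    then have i: "i < D" using Y(1) by simp
    then have "inv_into {..<D} ((!) Y) (Y ! i) = i"
      using nth by (intro inv_into_f_f) (auto simp: bij_betw_def)
    then show "map ?p Y ! i = [1..<Suc D] ! i" using i Y(1) by (simp del: upt_Suc)
  qed (use Y(1) in simp)
  ultimately show ?thesis by blast
qed

text \<open>\<open>separated\<close> and \<open>route\<close> for an arbitrary target
  \<open>Y\<close>, with \<open>hd Y\<close> in the role of 1.\<close>

definition separated_routes :: "nat \<Rightarrow> nat list \<Rightarrow> nat list \<Rightarrow> (nat list \<Rightarrow> nat) \<Rightarrow> bool" where
  "separated_routes \<Delta> X Y L \<longleftrightarrow> L X = 0 \<and> L Y = 0 \<and>
     (\<forall>a \<in> {1..\<Delta> + 1} - {hd X}. mtf a X \<noteq> Y \<longrightarrow> (\<exists>w.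
        set w \<subseteq> {1..\<Delta> + 1} \<and> distinct w \<and> length w \<le> length X \<and>
        (w = [] \<or> (\<exists>z. z \<notin> set w \<and> prec (mtf a X) z (last w))) \<and>
        hd (w @ [a]) \<noteq> hd Y \<and> mtf (hd Y) (foldr mtf w (mtf a X)) = Y \<and>
        (\<forall>s. suffix s w \<longrightarrow> L (foldr mtf s (mtf a X)) = a)))"

lemma ex_separated_routes:
  assumes D: "1 \<le> D" "D \<le> \<Delta>" and XY: "X \<in> cp_verts \<Delta> D" "Y \<in> cp_verts \<Delta> D" "X \<noteq> Y"
  shows "\<exists>L. separated_routes \<Delta> X Y L"
proof -
  let ?A = "{1..\<Delta> + 1}"
  obtain \<pi> where \<pi>: "bij \<pi>" "\<pi> ` ?A = ?A" "\<pi> 0 = 0" "map \<pi> Y = [1..<Suc D]"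
    using ex_relabelling[OF XY(2) D(2)] by blast
  have inj: "inj \<pi>" using \<pi>(1) by (rule bij_is_inj)
  have mem: "\<pi> a \<in> ?A \<longleftrightarrow> a \<in> ?A" for a
    using inj \<pi>(2) by (metis inj_image_mem_iff)
  define \<rho> where "\<rho> = inv \<pi>"
  have \<rho>: "\<rho> (\<pi> a) = a" "\<pi> (\<rho> a) = a" for a
    using \<pi>(1) by (auto simp: \<rho>_def bij_is_inj bij_is_surj surj_f_inv_f)
  have ne: "X \<noteq> []" "Y \<noteq> []" using XY D by (auto simp: cp_verts_def)
  interpret cp_start D \<Delta> "map \<pi> X"
  proof
    show "length (map \<pi> X) = D" "distinct (map \<pi> X)"
      using XY(1) inj by (auto simp: cp_verts_def distinct_map inj_on_def inj_def)
    show "set (map \<pi> X) \<subseteq> {1..\<Delta> + 1}" using XY(1) \<pi>(2) by (auto simp: cp_verts_def)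
    show "map \<pi> X \<noteq> [1..<Suc D]" using XY(3) inj \<pi>(4) by (metis map_injective)
  qed (use D in auto)
  obtain L where L: "separated L" using ex_separated by blast
  have x': "hd (map \<pi> X) = \<pi> (hd X)" using ne by (simp add: hd_map)
  have y: "\<pi> (hd Y) = 1" using \<pi>(4) ne D by (metis hd_map hd_upt Suc_le_lessD less_SucI Suc_le_mono le0 less_Suc_eq_le One_nat_def)
  \<comment> \<open>Labels are letters, so they are renamed back as well.\<close>
  let ?L = "\<lambda>V. \<rho> (L (map \<pi> V))"
  have "separated_routes \<Delta> X Y ?L"
    unfolding separated_routes_def
  proof (intro conjI ballI impI)
    show "?L X = 0" "?L Y = 0" using L \<pi>(3,4) \<rho>(1)[of 0] by (auto simp: separated_def simp del: upt_Suc)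
    fix a assume a: "a \<in> ?A - {hd X}" "mtf a X \<noteq> Y"
    have "\<pi> a \<in> ?A - {hd (map \<pi> X)}" using a(1) mem[of a] inj x' by (simp add: inj_eq)
    moreover have "mtf (\<pi> a) (map \<pi> X) \<noteq> [1..<Suc D]"
      unfolding mtf_map[OF inj] \<pi>(4)[symmetric] using a(2) inj by (metis map_injective)
    ultimately obtain w where w: "route (\<pi> a) w L"
      using L unfolding separated_def x_def by blast
    define v where "v = map \<rho> w"
    have wv: "w = map \<pi> v" by (simp add: v_def o_def \<rho>)
    note r = w[unfolded route_def mtf_map[OF inj] wv]
    have f: "foldr mtf (map \<pi> s) (map \<pi> (mtf a X)) = map \<pi> (foldr mtf s (mtf a X))" for s
      by (rule foldr_mtf_map[OF inj])
    show "\<exists>w. set w \<subseteq> {1..\<Delta> + 1} \<and> distinct w \<and> length w \<le> length X \<and>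
        (w = [] \<or> (\<exists>z. z \<notin> set w \<and> prec (mtf a X) z (last w))) \<and>
        hd (w @ [a]) \<noteq> hd Y \<and> mtf (hd Y) (foldr mtf w (mtf a X)) = Y \<and>
        (\<forall>s. suffix s w \<longrightarrow> ?L (foldr mtf s (mtf a X)) = a)"
    proof (intro exI[of _ v] conjI allI impI)
      show "set v \<subseteq> {1..\<Delta> + 1}"
      proof
        fix b assume "b \<in> set v"
        then have "\<pi> b \<in> ?A" using r by auto
        then show "b \<in> ?A" using mem by blast
      qed
      show "distinct v" using r by (auto simp: distinct_map)
      show "length v \<le> length X" using r XY(1) by (simp add: cp_verts_def)
      show "v = [] \<or> (\<exists>z. z \<notin> set v \<and> prec (mtf a X) z (last v))"
      proof (cases "v = []")
        case False
        then obtain z where z: "z \<notin> set (map \<pi> v)" "prec (map \<pi> (mtf a X)) z (\<pi> (last v))"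
          using r by (auto simp: last_map)
        have "z = \<pi> (\<rho> z)" by (simp add: \<rho>)
        then have "\<rho> z \<notin> set v" "prec (mtf a X) (\<rho> z) (last v)"
          using z prec_map[OF inj, of "mtf a X" "\<rho> z" "last v"] by auto
        then show ?thesis by blast
      qed simp
      show "hd (v @ [a]) \<noteq> hd Y"
      proof
        assume "hd (v @ [a]) = hd Y"
        then have "hd (map \<pi> v @ [\<pi> a]) = 1" using y by (cases v) auto
        then show False using r by blast
      qed
      have "map \<pi> (mtf (hd Y) (foldr mtf v (mtf a X))) = mtf 1 (foldr mtf (map \<pi> v) (map \<pi> (mtf a X)))"
        unfolding f y[symmetric] mtf_map[OF inj] ..
      also have "\<dots> = map \<pi> Y" using r \<pi>(4) by simp
      finally show "mtf (hd Y) (foldr mtf v (mtf a X)) = Y" using inj by (metis map_injective)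
      fix s assume "suffix s v"
      then have "suffix (map \<pi> s) (map \<pi> v)" by (auto simp: suffix_def)
      then have "L (foldr mtf (map \<pi> s) (map \<pi> (mtf a X))) = \<pi> a" using r by blast
      then show "?L (foldr mtf s (mtf a X)) = a" unfolding f by (simp add: \<rho>)
    qed
  qed
  then show ?thesis by blast
qed

section \<open>Linkages, containers and the wide diameter\<close>

context
  fixes \<Delta> D :: nat and G :: "nat list pair_pre_digraph"
  assumes D: "1 \<le> D" "D \<le> \<Delta>"
  defines G: "G \<equiv> cycle_prefix_digraph \<Delta> D"
begin

lemma pverts_G: "pverts G = cp_verts \<Delta> D"
  by (simp add: G)

lemma finite_verts: "finite (pverts G)"
proof -
  have "pverts G \<subseteq> {xs. set xs \<subseteq> {1..\<Delta> + 1} \<and> length xs = D}" by (auto simp: pverts_G cp_verts_def)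
  then show ?thesis using finite_lists_length_eq[of "{1..\<Delta> + 1}" D] finite_subset by blast
qed

lemma arc_in_verts: "(X, Z) \<in> parcs G \<Longrightarrow> X \<in> pverts G \<and> Z \<in> pverts G"
  using arcs_iff[OF D(1)] mtf_in_verts D(1) unfolding G by fastforce

lemma arc_neq: "(X, Z) \<in> parcs G \<Longrightarrow> X \<noteq> Z"
  using arcs_iff[OF D(1)] cp_verts_hd D(1) unfolding G by (metis hd_mtf)

text \<open>\<open>P Z\<close> is the path that starts at \<open>Z\<close>; its last vertex will be
  \<theta>(Z). The bound on its length is meant for containers.\<close>

definition linkage :: "nat list \<Rightarrow> nat list \<Rightarrow> (nat list \<Rightarrow> nat list list) \<Rightarrow> bool" where
  "linkage X Y P \<longleftrightarrow>
     (\<forall>Z \<in> out_nbrs G X - {Y}. is_shortest_path G Z (P Z) (last (P Z)) \<and>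
        shortest_path G Z (last (P Z)) = P Z \<and> length (P Z) \<le> Suc D \<and>
        last (P Z) \<in> in_nbrs G Y \<and> X \<notin> set (P Z) \<and> Y \<notin> set (P Z)) \<and>
     disjoint_family_on (\<lambda>Z. set (P Z)) (out_nbrs G X - {Y})"

lemma ex_linkage:
  assumes XY: "X \<in> pverts G" "Y \<in> pverts G" "X \<noteq> Y"
  shows "\<exists>P. linkage X Y P"
proof -
  have XY': "X \<in> cp_verts \<Delta> D" "Y \<in> cp_verts \<Delta> D" using XY by (auto simp: pverts_G)
  have X: "X \<noteq> []" "length X = D" using XY'(1) D by (auto simp: cp_verts_def)
  obtain L where L: "separated_routes \<Delta> X Y L" using ex_separated_routes[OF D XY' XY(3)] by blast
  define good where "good a w \<longleftrightarrow> set w \<subseteq> {1..\<Delta> + 1} \<and> distinct w \<and> length w \<le> length X \<and>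
        (w = [] \<or> (\<exists>z. z \<notin> set w \<and> prec (mtf a X) z (last w))) \<and>
        hd (w @ [a]) \<noteq> hd Y \<and> mtf (hd Y) (foldr mtf w (mtf a X)) = Y \<and>
        (\<forall>s. suffix s w \<longrightarrow> L (foldr mtf s (mtf a X)) = a)" for a w
  have "\<forall>a \<in> {1..\<Delta> + 1} - {hd X}. mtf a X \<noteq> Y \<longrightarrow> (\<exists>w. good a w)"
    using L unfolding separated_routes_def good_def by blast
  then obtain W where W: "\<And>a. a \<in> {1..\<Delta> + 1} \<Longrightarrow> a \<noteq> hd X \<Longrightarrow> mtf a X \<noteq> Y \<Longrightarrow> good a (W a)"
    by (metis Diff_iff singletonD)
  have L0: "L X = 0" "L Y = 0" using L unfolding separated_routes_def by auto
  define P where "P Z = trail (W (hd Z)) Z" for Z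
  have nbr: "Z \<in> out_nbrs G X - {Y} \<Longrightarrow> Z = mtf (hd Z) X \<and> hd Z \<in> {1..\<Delta> + 1} \<and> good (hd Z) (W (hd Z))" for Z
    using W X(1) unfolding G out_nbrs_eq[OF D(1) XY'(1)] by auto
  have lab: "L V = hd Z" if "Z \<in> out_nbrs G X - {Y}" "V \<in> set (P Z)" for V Z
    using nbr[OF that(1)] that(2) unfolding P_def set_trail good_def by auto
  have "linkage X Y P" unfolding linkage_def
  proof (intro conjI ballI)
    \<comment> \<open>All vertices of \<open>P Z\<close> have the label \<open>hd Z\<close>, and
      this letter determines \<open>Z\<close>.\<close>
    show "disjoint_family_on (\<lambda>Z. set (P Z)) (out_nbrs G X - {Y})"
      unfolding disjoint_family_on_def using lab nbr by (metis disjoint_iff)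
    fix Z assume Z: "Z \<in> out_nbrs G X - {Y}"
    note n = nbr[OF Z]
    have w: "distinct (W (hd Z))" "length (W (hd Z)) \<le> D" "set (W (hd Z)) \<subseteq> {1..\<Delta> + 1}"
      "W (hd Z) = [] \<or> (\<exists>z. z \<notin> set (W (hd Z)) \<and> prec Z z (last (W (hd Z))))"
      using n X(2) unfolding good_def by auto
    have ZV: "Z \<in> cp_verts \<Delta> D" using n mtf_in_verts[OF XY'(1) D(1)] by metis
    have l: "last (P Z) = foldr mtf (W (hd Z)) Z" by (simp add: P_def)
    show "is_shortest_path G Z (P Z) (last (P Z))" "shortest_path G Z (last (P Z)) = P Z"
      unfolding l unfolding P_def G by (rule trail_shortest[OF D(1) ZV w])+
    show "length (P Z) \<le> Suc D" using w(2) by (simp add: P_def)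
    have lv: "last (P Z) \<in> cp_verts \<Delta> D" unfolding l by (rule mtfs_in_verts[OF ZV D(1) w(3)])
    have "hd (last (P Z)) = hd (W (hd Z) @ [hd Z])"
    proof (cases "W (hd Z)")
      case (Cons b u)
      then have "foldr mtf u Z \<in> cp_verts \<Delta> D" using w(3) by (intro mtfs_in_verts[OF ZV D(1)]) auto
      then have "foldr mtf u Z \<noteq> []" using cp_verts_hd D(1) by blast
      then show ?thesis using Cons by (simp add: l)
    qed (simp add: l)
    then show "last (P Z) \<in> in_nbrs G Y"
      unfolding G in_nbrs_eq[OF D(1) XY'(2)] using n lv l unfolding good_def by auto
    have "hd Z \<noteq> 0" using n by auto
    then show "X \<notin> set (P Z)" "Y \<notin> set (P Z)" using lab[OF Z] L0 by auto
  qed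
  then show ?thesis by blast
qed

lemma finite_nbrs: "finite (out_nbrs G X)" "finite (in_nbrs G Y)"
proof -
  have "out_nbrs G X \<subseteq> pverts G" "in_nbrs G Y \<subseteq> pverts G"
    using arc_in_verts by (auto simp: out_nbrs_def in_nbrs_def)
  then show "finite (out_nbrs G X)" "finite (in_nbrs G Y)" using finite_verts finite_subset by blast+
qed

lemma card_out: "X \<in> pverts G \<Longrightarrow> card (out_nbrs G X) = \<Delta>"
  using card_out_nbrs[OF D(1)] by (simp add: G)

lemma linkage_inj:
  assumes "linkage X Y P"
  shows "inj_on (\<lambda>Z. last (P Z)) (out_nbrs G X - {Y})"
    and "(\<lambda>Z. last (P Z)) ` (out_nbrs G X - {Y}) \<subseteq> in_nbrs G Y - {X}"
proof -
  have ne: "last (P Z) \<in> set (P Z)" if "Z \<in> out_nbrs G X - {Y}" for Z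
    using assms that unfolding linkage_def is_shortest_path_def path_from_to_def vpath_def vwalk_def by auto
  show "inj_on (\<lambda>Z. last (P Z)) (out_nbrs G X - {Y})"
    using assms ne unfolding linkage_def disjoint_family_on_def inj_on_def by (metis disjoint_iff)
  show "(\<lambda>Z. last (P Z)) ` (out_nbrs G X - {Y}) \<subseteq> in_nbrs G Y - {X}"
    using assms ne unfolding linkage_def by fastforce
qed

lemma card_nbrs_minus:
  assumes "X \<in> pverts G"
  shows "card (out_nbrs G X - {Y}) = (if (X, Y) \<in> parcs G then \<Delta> - 1 else \<Delta>)"
    and "card (in_nbrs G Y - {X}) = (if (X, Y) \<in> parcs G then card (in_nbrs G Y) - 1 else card (in_nbrs G Y))"
  using card_out[OF assms] by (auto simp: out_nbrs_def in_nbrs_def card_Diff_singleton_if)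

text \<open>Linkages bound every in-degree from below by \<open>\<Delta>\<close>, and the in-degrees sum up to the number of arcs.\<close>

lemma card_in:
  assumes "Y \<in> pverts G"
  shows "card (in_nbrs G Y) = \<Delta>"
proof -
  have ge: "\<Delta> \<le> card (in_nbrs G Y)" if Y: "Y \<in> pverts G" for Y
  proof -
    have "out_nbrs G Y \<noteq> {}" using card_out[OF Y] D by auto
    then obtain X where "(Y, X) \<in> parcs G" by (auto simp: out_nbrs_def)
    then have X: "X \<in> pverts G" "X \<noteq> Y" using arc_in_verts arc_neq by blast+
    obtain P where P: "linkage X Y P" using ex_linkage[OF X(1) Y X(2)] by blast
    have "card (out_nbrs G X - {Y}) \<le> card (in_nbrs G Y - {X})"
      using card_inj_on_le[OF linkage_inj[OF P]] finite_nbrs by simp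
    \<comment> \<open>If \<open>(X, Y)\<close> is an arc, both sets lose one element; as the
      in-degree is positive, natural subtraction does no harm.\<close>
    moreover have "card (in_nbrs G Y) \<noteq> 0" if "(X, Y) \<in> parcs G"
      using that finite_nbrs(2)[of Y] by (auto simp: in_nbrs_def)
    ultimately show ?thesis using card_nbrs_minus[OF X(1), of Y] D by (auto split: if_splits)
  qed
  have out: "parcs G = Sigma (pverts G) (out_nbrs G)"
    using arc_in_verts by (auto simp: out_nbrs_def)
  have inn: "(parcs G)\<inverse> = Sigma (pverts G) (in_nbrs G)"
    using arc_in_verts by (auto simp: in_nbrs_def)
  have "(\<Sum>Y\<in>pverts G. card (in_nbrs G Y)) = card ((parcs G)\<inverse>)"
    unfolding inn using finite_verts finite_nbrs by (simp add: card_SigmaI)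
  also have "\<dots> = card (parcs G)" by (rule card_inverse)
  also have "\<dots> = (\<Sum>X\<in>pverts G. card (out_nbrs G X))"
    unfolding out using finite_verts finite_nbrs by (simp add: card_SigmaI)
  also have "\<dots> = (\<Sum>Y\<in>pverts G. \<Delta>)" using card_out by simp
  finally have "(\<Sum>Y\<in>pverts G. card (in_nbrs G Y)) = (\<Sum>Y\<in>pverts G. \<Delta>)" .
  then show ?thesis using sum_mono_inv[of "\<lambda>_. \<Delta>" "pverts G" "\<lambda>Y. card (in_nbrs G Y)" Y] ge assms finite_verts by simp
qed

text \<open>An injection between finite sets of equal size: all in- and out-degrees are \<Delta>,
  and an arc from \<open>X\<close> to \<open>Y\<close> costs each side one element.\<close>

lemma linkage_bij:
  assumes "X \<in> pverts G" "Y \<in> pverts G" "linkage X Y P"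
  shows "bij_betw (\<lambda>Z. last (P Z)) (out_nbrs G X - {Y}) (in_nbrs G Y - {X})"
proof -
  have "card (in_nbrs G Y - {X}) = card ((\<lambda>Z. last (P Z)) ` (out_nbrs G X - {Y}))"
    using card_nbrs_minus[OF assms(1), of Y] card_in[OF assms(2)] card_image[OF linkage_inj(1)[OF assms(3)]]
    by simp
  then have "(\<lambda>Z. last (P Z)) ` (out_nbrs G X - {Y}) = in_nbrs G Y - {X}"
    using linkage_inj(2)[OF assms(3)] finite_nbrs by (intro card_subset_eq) auto
  then show ?thesis using linkage_inj(1)[OF assms(3)] by (simp add: bij_betw_def)
qed

text \<open>Adding \<open>X\<close> in front and \<open>Y\<close> behind gives at most
  \<open>D + 3\<close> vertices, hence length at most \<open>D + 2\<close>. If \<open>(X, Y)\<close>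
  is an arc, it is the one path that the linkage lacks.\<close>

lemma linkage_container:
  assumes XY: "X \<in> pverts G" "Y \<in> pverts G" "X \<noteq> Y"
  shows "\<exists>C. finite C \<and> card C = \<Delta> \<and> (\<forall>p \<in> C. path_from_to G X p Y \<and> vwalk_length p \<le> D + 2) \<and>
    (\<forall>p \<in> C. \<forall>q \<in> C. p \<noteq> q \<longrightarrow> set p \<inter> set q = {X, Y})"
proof -
  obtain P where P: "linkage X Y P" using ex_linkage[OF XY] by blast
  let ?N = "out_nbrs G X - {Y}"
  let ?f = "\<lambda>Z. X # P Z @ [Y]"
  let ?E = "if (X, Y) \<in> parcs G then {[X, Y]} else {}"
  have Pp: "vpath (P Z) (with_proj G)" "P Z \<noteq> []" "hd (P Z) = Z" "length (P Z) \<le> Suc D"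
    "(last (P Z), Y) \<in> parcs G" "X \<notin> set (P Z)" "Y \<notin> set (P Z)" if "Z \<in> ?N" for Z
    using P that unfolding linkage_def is_shortest_path_def path_from_to_def vpath_def vwalk_def in_nbrs_def
    by auto
  have path: "path_from_to G X (?f Z) Y" if Z: "Z \<in> ?N" for Z
  proof -
    have "vwalk (P Z) (with_proj G)" using Pp(1)[OF Z] by (simp add: vpath_def)
    then have "vwalk (P Z @ [Y]) (with_proj G)" using Pp(2,5)[OF Z] XY(2) by (simp add: vwalk_snoc)
    then have "vwalk (?f Z) (with_proj G)"
      using Pp(2,3)[OF Z] XY(1) Z by (intro vwalk_consI) (auto simp: out_nbrs_def)
    then show ?thesis using Pp(1,6,7)[OF Z] XY(3) by (auto simp: path_from_to_def vpath_def)
  qed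
  have disj: "set (?f Z) \<inter> set (?f Z') = {X, Y}" if "Z \<in> ?N" "Z' \<in> ?N" "Z \<noteq> Z'" for Z Z'
    using P that Pp(6,7)[OF that(1)] Pp(6,7)[OF that(2)] unfolding linkage_def disjoint_family_on_def by auto
  have inj: "inj_on ?f ?N" using Pp(3) by (intro inj_onI) (metis append_same_eq list.inject)
  have nE: "[X, Y] \<notin> ?f ` ?N" using Pp(2) by auto
  show ?thesis
  proof (intro exI[of _ "?f ` ?N \<union> ?E"] conjI ballI impI)
    show "finite (?f ` ?N \<union> ?E)" using finite_nbrs by simp
    have "card (?f ` ?N \<union> ?E) = card ?N + card ?E"
      using nE finite_nbrs by (subst card_Un_disjoint) (auto simp: card_image[OF inj])
    then show "card (?f ` ?N \<union> ?E) = \<Delta>" using card_nbrs_minus(1)[OF XY(1), of Y] D by simp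
    show "path_from_to G X p Y" if p: "p \<in> ?f ` ?N \<union> ?E" for p
    proof (cases "p \<in> ?f ` ?N")
      case True
      then obtain Z where "Z \<in> ?N" "p = ?f Z" by blast
      then show ?thesis using path by blast
    next
      case False
      then have "p = [X, Y]" "(X, Y) \<in> parcs G" using p by (auto split: if_splits)
      then show ?thesis using XY by (auto simp: path_from_to_def vpath_def vwalk_def)
    qed
    show "vwalk_length p \<le> D + 2" if "p \<in> ?f ` ?N \<union> ?E" for p
      using that Pp(4) by (force split: if_splits)
    show "set p \<inter> set q = {X, Y}" if "p \<in> ?f ` ?N \<union> ?E" "q \<in> ?f ` ?N \<union> ?E" "p \<noteq> q" for p q
    proof -
      have "set p \<inter> set q = {X, Y}" if "[X, Y] \<in> {p, q}"
        using that \<open>p \<in> _\<close> \<open>q \<in> _\<close> by (auto split: if_splits)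
      moreover have "set p \<inter> set q = {X, Y}" if pq: "[X, Y] \<notin> {p, q}"
      proof -
        have "p \<in> ?f ` ?N" "q \<in> ?f ` ?N" using \<open>p \<in> _\<close> \<open>q \<in> _\<close> pq by (auto split: if_splits)
        then obtain Z Z' where Z: "p = ?f Z" "q = ?f Z'" "Z \<in> ?N" "Z' \<in> ?N" by blast
        moreover from this have "Z \<noteq> Z'" using \<open>p \<noteq> q\<close> by blast
        ultimately show ?thesis using disj by blast
      qed
      ultimately show ?thesis by blast
    qed
  qed
qed

section \<open>Connectivity\<close>

lemma wf_G: "wf_digraph (with_proj G)"
  using arc_in_verts by unfold_locales auto

text \<open>A vertex of \<open>S\<close> lies on at most one of the \<Delta> internally disjoint
  paths from \<open>u\<close> to \<open>v\<close>, so some path avoids \<open>S\<close>.\<close>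

lemma connected_after_removal:
  assumes S: "S \<subseteq> pverts G" "card S < \<Delta>"
  shows "strongly_connected (with_proj G \<restriction> (pverts G - S))" and "1 < card (pverts G - S)"
proof -
  let ?H = "with_proj G \<restriction> (pverts G - S)"
  interpret wf_digraph "with_proj G" by (rule wf_G)
  interpret H: wf_digraph ?H by (rule wellformed_induce_subgraph)
  have "[1..<Suc D] \<in> pverts G" using D by (auto simp: pverts_G cp_verts_def simp del: upt_Suc)
  then obtain X0 where X0: "X0 \<in> pverts G" by blast
  have "insert X0 (out_nbrs G X0) \<subseteq> pverts G" using X0 arc_in_verts by (auto simp: out_nbrs_def)
  then have "card (insert X0 (out_nbrs G X0)) \<le> card (pverts G)" using finite_verts by (rule card_mono[rotated])
  moreover have "X0 \<notin> out_nbrs G X0" using arc_neq by (auto simp: out_nbrs_def)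
  ultimately have "Suc \<Delta> \<le> card (pverts G)" using card_out[OF X0] finite_nbrs(1) by simp
  then show c: "1 < card (pverts G - S)"
    using S finite_verts finite_subset by (subst card_Diff_subset) auto
  have "u \<rightarrow>\<^sup>*\<^bsub>?H\<^esub> v" if uv: "u \<in> pverts G - S" "v \<in> pverts G - S" for u v
  proof (cases "u = v")
    case True
    then show ?thesis using uv by simp
  next
    case False
    have uv': "u \<in> pverts G" "v \<in> pverts G" using uv by auto
    obtain C where C0: "finite C \<and> card C = \<Delta> \<and> (\<forall>p \<in> C. path_from_to G u p v \<and> vwalk_length p \<le> D + 2) \<and>
        (\<forall>p \<in> C. \<forall>q \<in> C. p \<noteq> q \<longrightarrow> set p \<inter> set q = {u, v})"
      using linkage_container[OF uv' False] ..
    then have C: "finite C" "card C = \<Delta>" "\<And>p. p \<in> C \<Longrightarrow> path_from_to G u p v"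
      "\<And>p q. p \<in> C \<Longrightarrow> q \<in> C \<Longrightarrow> p \<noteq> q \<Longrightarrow> set p \<inter> set q = {u, v}"
      by simp_all
    have "\<exists>p \<in> C. set p \<inter> S = {}"
    proof (rule ccontr)
      assume "\<not> ?thesis"
      then have "\<forall>p \<in> C. \<exists>s. s \<in> set p \<inter> S" by blast
      from bchoice[OF this] obtain g where g: "\<And>p. p \<in> C \<Longrightarrow> g p \<in> set p \<inter> S" by blast
      have "inj_on g C"
      proof (rule inj_onI, rule ccontr)
        fix p q assume pq: "p \<in> C" "q \<in> C" "g p = g q" "p \<noteq> q"
        have "g p \<in> set p \<inter> set q" using g[OF pq(1)] g[OF pq(2)] pq(3) by auto
        then have "g p \<in> {u, v}" using C(4)[OF pq(1,2,4)] by simp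
        then show False using g[OF pq(1)] uv by auto
      qed
      then have "card C \<le> card S" using g S finite_verts finite_subset by (intro card_inj_on_le[of g]) auto
      then show False using C(2) S(2) by simp
    qed
    then obtain p where p: "p \<in> C" "set p \<inter> S = {}" by blast
    have "vwalk p (with_proj G)" "hd p = u" "last p = v"
      using C(3)[OF p(1)] by (auto simp: path_from_to_def vpath_def)
    moreover from this have ps: "set p \<subseteq> pverts G - S" using p(2) by (auto simp: vwalk_def)
    moreover have "set (vwalk_arcs q) \<subseteq> set q \<times> set q" for q :: "nat list list"
      by (induction q rule: vwalk_arcs.induct) auto
    then have "set (vwalk_arcs p) \<subseteq> (pverts G - S) \<times> (pverts G - S)" using ps by blast
    moreover have "arcs_ends ?H = {e \<in> parcs G. fst e \<in> pverts G - S \<and> snd e \<in> pverts G - S}"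
      by (auto simp: arcs_ends_conv)
    ultimately have "vwalk p ?H"
      unfolding vwalk_def by auto
    then show ?thesis using H.reachable_vwalk_conv \<open>hd p = u\<close> \<open>last p = v\<close> by blast
  qed
  moreover have "pverts G - S \<noteq> {}" using c by (metis card.empty not_less_zero)
  ultimately show "strongly_connected ?H" by (simp add: strongly_connected_def)
qed

text \<open>Removing all out-neighbours of a vertex leaves it without outgoing arcs, or leaves
  nothing else.\<close>

lemma vertex_connectivity_eq: "vertex_connectivity G = \<Delta>"
  unfolding vertex_connectivity_def
proof (rule Least_equality)
  have "[1..<Suc D] \<in> pverts G" using D by (auto simp: pverts_G cp_verts_def simp del: upt_Suc)
  then obtain X where X: "X \<in> pverts G" by blast
  let ?S = "out_nbrs G X"
  let ?H = "with_proj G \<restriction> (pverts G - ?S)"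
  have S: "?S \<subseteq> pverts G" using arc_in_verts by (auto simp: out_nbrs_def)
  have XS: "X \<notin> ?S" using arc_neq by (auto simp: out_nbrs_def)
  have "\<not> strongly_connected ?H \<or> card (pverts G - ?S) \<le> 1"
  proof (cases "pverts G - ?S = {X}")
    case False
    then obtain V where V: "V \<in> pverts G - ?S" "V \<noteq> X" using X XS by blast
    have "\<not> X \<rightarrow>\<^sup>*\<^bsub>?H\<^esub> V"
    proof
      assume "X \<rightarrow>\<^sup>*\<^bsub>?H\<^esub> V"
      then obtain Z where "X \<rightarrow>\<^bsub>?H\<^esub> Z"
        using V(2) by (cases rule: pre_digraph.converse_reachable_cases) auto
      then show False by (auto simp: arcs_ends_conv out_nbrs_def)
    qed
    then show ?thesis using X XS V by (auto simp: strongly_connected_def)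
  qed simp
  then show "\<exists>S\<subseteq>pverts G. card S = \<Delta> \<and>
      (\<not> strongly_connected (with_proj G \<restriction> (pverts G - S)) \<or> card (pverts G - S) \<le> 1)"
    using S card_out[OF X] by blast
  show "\<Delta> \<le> k" if "\<exists>S\<subseteq>pverts G. card S = k \<and>
      (\<not> strongly_connected (with_proj G \<restriction> (pverts G - S)) \<or> card (pverts G - S) \<le> 1)" for k
    using that connected_after_removal by (metis not_le)
qed

lemma wide_diameter_le: "wide_diameter G \<le> enat (D + 2)"
proof -
  have "wide_distance G X Y \<le> enat (D + 2)" if XY: "X \<in> pverts G" "Y \<in> pverts G" "X \<noteq> Y" for X Y
  proof -
    obtain C where C: "finite C" "card C = \<Delta>" "\<forall>p \<in> C. path_from_to G X p Y \<and> vwalk_length p \<le> D + 2"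
      "\<forall>p \<in> C. \<forall>q \<in> C. p \<noteq> q \<longrightarrow> set p \<inter> set q = {X, Y}"
      using linkage_container[OF XY] by blast
    then have "C \<in> containers G X Y" by (simp add: containers_def vertex_connectivity_eq)
    moreover have "container_length C \<le> enat (D + 2)"
      unfolding container_length_def using C(3) by (intro SUP_least) auto
    ultimately show ?thesis unfolding wide_distance_def by (rule INF_lower2)
  qed
  then show ?thesis unfolding wide_diameter_def by (intro SUP_least) auto
qed

section \<open>The lower bound on the wide diameter\<close>

lemma long_walk:
  assumes Z: "Z \<in> pverts G" "prec Z (Suc D) D"
    and p: "vwalk p (with_proj G)" "hd p = Z" "last (last p) = D" "Suc D \<notin> set (last p)"
  shows "D < length p"
proof (rule ccontr)
  assume np: "\<not> D < length p"
  have Z': "distinct Z" "Z \<noteq> []" "length Z = D" using Z D by (auto simp: pverts_G cp_verts_def)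
  obtain w where w: "p = trail w Z" using vwalk_imp_trail[OF D(1)] p(1,2) unfolding G by blast
  obtain r where r: "distinct r" "foldr mtf r Z = foldr mtf w Z" "r = w \<or> length r < length w"
    using ex_distinct_word[OF Z'(1,2)] by blast
  have lr: "length r < D" using np r(3) w by auto
  let ?F = "filter (\<lambda>b. b \<notin> set r) Z"
  have W: "last p = r @ take (D - length r) ?F"
    using w r(2) mtfs_pull[OF Z'(1,2) r(1)] lr by (simp add: pull_def Z'(3))
  have "length (last p) = D" using W length_pull[OF Z'(1), of r] w r(2) mtfs_pull[OF Z'(1,2) r(1)] Z'(3) by simp
  then have "length (take (D - length r) ?F) = D - length r" using W by (metis add_diff_cancel_left' length_append)
  then have ne: "take (D - length r) ?F \<noteq> []" using lr by auto
  \<comment> \<open>Fewer than \<open>D\<close> letters have been moved, so the last letter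
    \<open>D\<close> is an unmoved one. The letter \<open>D + 1\<close> is unmoved too and stands
    before it, so it could not have been pushed out.\<close>
  then have Din: "D \<in> set (take (D - length r) ?F)" using W p(3) last_in_set[OF ne] by simp
  then have "D \<notin> set r" by (auto dest: in_set_takeD)
  moreover have "Suc D \<notin> set r" using W p(4) by simp
  ultimately have "prec ?F (Suc D) D" using Z(2) by (subst prec_filter) auto
  then have "prec (take (D - length r) ?F) (Suc D) D" using Din by (rule prec_take)
  then show False using prec_in_set W p(4) by fastforce
qed

lemma wide_distance_ge:
  assumes D4: "4 \<le> D"
  defines "X \<equiv> Suc D # [2..<Suc D]" and "Y \<equiv> [1..<Suc D]"
  shows "X \<in> pverts G" "Y \<in> pverts G" "X \<noteq> Y" "enat (D + 2) \<le> wide_distance G X Y"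
proof -
  have X: "length X = D" "distinct X" "set X \<subseteq> {1..\<Delta> + 1}" "X \<noteq> []" "hd X = Suc D"
    using D by (auto simp: X_def simp del: upt_Suc)
  have Y: "hd Y = 1" using D by (simp add: Y_def hd_upt del: upt_Suc)
  show XV: "X \<in> pverts G" using X by (simp add: pverts_G cp_verts_def)
  show YV: "Y \<in> pverts G" using D by (auto simp: Y_def pverts_G cp_verts_def simp del: upt_Suc)
  show XY: "X \<noteq> Y" using X(5) Y D by auto
  have arcX: "\<exists>a. a \<in> {1..\<Delta> + 1} \<and> a \<noteq> Suc D \<and> Z = mtf a X" if "(X, Z) \<in> parcs G" for Z
    using that X(5) arcs_iff[OF D(1)] unfolding G by auto
  \<comment> \<open>Every out-neighbour of \<open>X\<close> has \<open>D + 1\<close> in second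
    place. Hence all paths of a container have inner vertices.\<close>
  have noarc: "(X, Y) \<notin> parcs G"
  proof
    assume "(X, Y) \<in> parcs G"
    then obtain a where a: "Y = mtf a X" "a \<noteq> Suc D" using arcX by blast
    have "mtf a X ! 1 = Suc D"
      using a(2) D4 X(1) by (simp add: mtf_def X_def nth_Cons' del: upt_Suc)
    moreover have "Y ! 1 = 2" using D4 by (simp add: Y_def del: upt_Suc)
    ultimately show False using a D4 by simp
  qed
  \<comment> \<open>The in-neighbours with 1 in second and third place; \<open>4 \<le> D\<close>
    leaves \<open>D\<close> as the last letter of both.\<close>
  let ?W2 = "[2, 1] @ [3..<Suc D]" and ?W3 = "[2, 3, 1] @ [4..<Suc D]"
  have up: "[1..<Suc D] = 1 # 2 # 3 # [4..<Suc D]" "[3..<Suc D] = 3 # [4..<Suc D]"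
    using D4 by (simp_all add: upt_conv_Cons numeral_eq_Suc del: upt_Suc)
  have last4: "last [4..<Suc D] = D" "[4..<Suc D] \<noteq> []" using D4 by (simp_all)
  have W: "W \<in> in_nbrs G Y" "last W = D" "Suc D \<notin> set W" if "W \<in> {?W2, ?W3}" for W
  proof -
    have "filter (\<lambda>b. b \<noteq> 1) [4..<Suc D] = [4..<Suc D]" by (simp add: filter_neq_id del: upt_Suc)
    then have "1 # filter (\<lambda>b. b \<noteq> 1) W = Y" using that up by (auto simp: Y_def simp del: upt_Suc)
    moreover have "length W = D" using that D4 by (auto simp del: upt_Suc)
    moreover have "take D Y = Y" by (simp add: Y_def del: upt_Suc)
    ultimately have "mtf 1 W = Y" by (simp add: mtf_def)
    moreover have "W \<in> cp_verts \<Delta> D" using that D D4 by (auto simp: cp_verts_def simp del: upt_Suc)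
    moreover have "hd W \<noteq> 1" using that by auto
    ultimately show "W \<in> in_nbrs G Y"
      using in_nbrs_eq[OF D(1), of Y \<Delta>] YV Y by (simp add: G del: One_nat_def)
    show "last W = D" using that last4 up(2) by (auto simp del: upt_Suc)
    show "Suc D \<notin> set W" using that D4 by (auto simp del: upt_Suc)
  qed
  have early: "prec (mtf a X) (Suc D) D" if "a \<noteq> D" "a \<noteq> Suc D" for a
  proof -
    have "mtf a X = take D (a # Suc D # filter (\<lambda>b. b \<noteq> a) [2..<Suc D])"
      using that(2) unfolding mtf_def X(1) by (simp add: X_def del: upt_Suc)
    also have "\<dots> = a # Suc D # take (D - 2) (filter (\<lambda>b. b \<noteq> a) [2..<Suc D])"
      using D4 by (simp add: take_Cons' numeral_2_eq_2 del: upt_Suc)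
    finally show ?thesis using that(1) by simp
  qed
  have "enat (D + 2) \<le> container_length C" if C: "C \<in> containers G X Y" for C
  proof -
    have C': "finite C" "card C = \<Delta>" "\<And>p. p \<in> C \<Longrightarrow> path_from_to G X p Y"
      "\<And>p q. p \<in> C \<Longrightarrow> q \<in> C \<Longrightarrow> p \<noteq> q \<Longrightarrow> set p \<inter> set q = {X, Y}"
      using C by (auto simp: containers_def vertex_connectivity_eq)
    have dec: "\<exists>q. p = X # q @ [Y] \<and> q \<noteq> [] \<and> vwalk q (with_proj G) \<and> (X, hd q) \<in> parcs G
        \<and> (last q, Y) \<in> parcs G \<and> X \<notin> set q \<and> Y \<notin> set q" if "p \<in> C" for p
    proof -
      have p: "vwalk p (with_proj G)" "distinct p" "p \<noteq> []" "hd p = X" "last p = Y"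
        using C'(3)[OF that] by (auto simp: path_from_to_def vpath_def vwalk_def)
      then obtain p' where p': "p = X # p'" by (cases p) auto
      then have "p' \<noteq> []" using p(5) XY by auto
      then obtain q where q: "p = X # q @ [Y]" using p' p(5) by (metis append_butlast_last_id last_ConsR)
      have "q \<noteq> []" using q p(1) noarc by (auto simp: vwalk_def)
      then obtain b q' where bq: "q = b # q'" by (cases q) auto
      have v: "vwalk (X # q) (with_proj G)" "(last q, Y) \<in> parcs G"
        using p(1) \<open>q \<noteq> []\<close> vwalk_snoc[of "X # q" Y "with_proj G"] unfolding q by auto
      then have "vwalk q (with_proj G)" "(X, hd q) \<in> parcs G" unfolding bq by (auto simp: vwalk_def)
      then show ?thesis using q v \<open>q \<noteq> []\<close> p(2) by auto
    qed
    define Q where "Q p = butlast (tl p)" for p :: "nat list list"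
    have Q: "p = X # Q p @ [Y]" "Q p \<noteq> []" "vwalk (Q p) (with_proj G)" "(X, hd (Q p)) \<in> parcs G"
      "(last (Q p), Y) \<in> parcs G" "X \<notin> set (Q p)" "Y \<notin> set (Q p)" if p: "p \<in> C" for p
    proof -
      obtain q where q: "p = X # q @ [Y]" "q \<noteq> [] \<and> vwalk q (with_proj G) \<and> (X, hd q) \<in> parcs G
        \<and> (last q, Y) \<in> parcs G \<and> X \<notin> set q \<and> Y \<notin> set q" using dec[OF p] by blast
      then have "Q p = q" by (simp add: Q_def)
      then show "p = X # Q p @ [Y]" "Q p \<noteq> []" "vwalk (Q p) (with_proj G)" "(X, hd (Q p)) \<in> parcs G"
        "(last (Q p), Y) \<in> parcs G" "X \<notin> set (Q p)" "Y \<notin> set (Q p)" using q by simp_all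
    qed
    have disj: "set (Q p) \<inter> set (Q q) = {}" if "p \<in> C" "q \<in> C" "p \<noteq> q" for p q
    proof -
      have "set (Q p) \<subseteq> set p" if "p \<in> C" for p by (subst (2) Q(1)[OF that]) auto
      then have "set (Q p) \<subseteq> set p" "set (Q q) \<subseteq> set q" using that by blast+
      then have "set (Q p) \<inter> set (Q q) \<subseteq> {X, Y}" using C'(4)[OF that] by blast
      then show ?thesis using Q(6,7)[OF that(1)] by blast
    qed
    have hdin: "hd (Q p) \<in> set (Q p)" and lastin: "last (Q p) \<in> set (Q p)" if "p \<in> C" for p
      using Q(2)[OF that] by auto
    have inj: "inj_on (\<lambda>p. last (Q p)) C"
    proof (rule inj_onI, rule ccontr)
      fix p q assume "p \<in> C" "q \<in> C" "last (Q p) = last (Q q)" "p \<noteq> q"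
      then show False using disj[of p q] lastin[of p] lastin[of q] by auto
    qed
    have sub: "(\<lambda>p. last (Q p)) ` C \<subseteq> in_nbrs G Y" using Q(5) by (auto simp: in_nbrs_def)
    \<comment> \<open>The last inner vertices are \<Delta> distinct in-neighbours of
      \<open>Y\<close>, so every in-neighbour occurs.\<close>
    have "card ((\<lambda>p. last (Q p)) ` C) = card (in_nbrs G Y)"
      using card_image[OF inj] C'(2) card_in[OF YV] by simp
    then have "(\<lambda>p. last (Q p)) ` C = in_nbrs G Y" using card_subset_eq[OF finite_nbrs(2) sub] by simp
    moreover have "?W2 \<in> in_nbrs G Y" "?W3 \<in> in_nbrs G Y" using W(1) by blast+
    ultimately obtain p2 p3 where p23: "p2 \<in> C" "last (Q p2) = ?W2" "p3 \<in> C" "last (Q p3) = ?W3"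
      by (metis (no_types, lifting) imageE)
    have "?W2 \<noteq> ?W3" by simp
    then have "p2 \<noteq> p3" using p23 by metis
    then have hd23: "hd (Q p2) \<noteq> hd (Q p3)"
      using disj[OF p23(1,3)] hdin[OF p23(1)] hdin[OF p23(3)] by auto
    \<comment> \<open>At most one of two disjoint paths starts at \<open>mtf D X\<close>, the only
      out-neighbour with \<open>D\<close> before \<open>D + 1\<close>.\<close>
    then have "\<exists>p \<in> {p2, p3}. hd (Q p) \<noteq> mtf D X" by auto
    then obtain p where p: "p \<in> {p2, p3}" "hd (Q p) \<noteq> mtf D X" by blast
    have pC: "p \<in> C" and pW: "last (Q p) \<in> {?W2, ?W3}" using p(1) p23 by auto
    obtain a where a: "a \<in> {1..\<Delta> + 1}" "a \<noteq> Suc D" "hd (Q p) = mtf a X" using arcX Q(4)[OF pC] by blast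
    have "D < length (Q p)"
    proof (rule long_walk)
      show "hd (Q p) \<in> pverts G" using arc_in_verts Q(4)[OF pC] by blast
      show "prec (hd (Q p)) (Suc D) D" unfolding a(3) using early a p(2) by metis
    qed (use Q(3)[OF pC] W(2,3)[OF pW] in auto)
    then have "D + 2 \<le> vwalk_length p" using Q(1)[OF pC] by (metis Suc_leI add_2_eq_Suc' diff_Suc_1 length_Cons length_append_singleton vwalk_length_simp Suc_le_mono)
    then have "enat (D + 2) \<le> enat (vwalk_length p)" by simp
    also have "\<dots> \<le> container_length C" unfolding container_length_def using pC by (rule SUP_upper)
    finally show ?thesis .
  qed
  then show "enat (D + 2) \<le> wide_distance G X Y" unfolding wide_distance_def by (rule INF_greatest)
qed

lemma wide_diameter_ge: "4 \<le> D \<Longrightarrow> enat (D + 2) \<le> wide_diameter G"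
  unfolding wide_diameter_def
  using wide_distance_ge by (intro SUP_upper2[where i = "(Suc D # [2..<Suc D], [1..<Suc D])"]) auto

end

theorem theorem4p1:
  fixes \<Delta> D :: nat and G :: "nat list pair_pre_digraph"
  assumes "1 \<le> D" and "D \<le> \<Delta>"
  defines "G \<equiv> cycle_prefix_digraph \<Delta> D"
  shows "wide_diameter G \<le> enat (D + 2)
    \<and> (4 \<le> D \<longrightarrow> wide_diameter G = enat (D + 2))
    \<and> (\<forall>X \<in> pverts G. \<forall>Y \<in> pverts G. X \<noteq> Y \<longrightarrow>
         (\<exists>\<theta>. bij_betw \<theta> (out_nbrs G X - {Y}) (in_nbrs G Y - {X})
            \<and> disjoint_family_on (\<lambda>Z. set (shortest_path G Z (\<theta> Z))) (out_nbrs G X - {Y})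
            \<and> (\<forall>Z \<in> out_nbrs G X - {Y}.
                 X \<notin> set (shortest_path G Z (\<theta> Z)) \<and> Y \<notin> set (shortest_path G Z (\<theta> Z)))))"
proof (intro conjI impI ballI)
  show le: "wide_diameter G \<le> enat (D + 2)" using wide_diameter_le assms(1,2) unfolding G_def by blast
  show "wide_diameter G = enat (D + 2)" if "4 \<le> D"
    using le wide_diameter_ge[OF assms(1,2) that] unfolding G_def by (intro antisym)
  fix X Y assume XY: "X \<in> pverts G" "Y \<in> pverts G" "X \<noteq> Y"
  obtain P where P: "linkage \<Delta> D X Y P" using ex_linkage[OF assms(1,2)] XY unfolding G_def by blast
  let ?N = "out_nbrs G X - {Y}"
  have sp: "shortest_path G Z (last (P Z)) = P Z" "X \<notin> set (P Z)" "Y \<notin> set (P Z)" if "Z \<in> ?N" for Z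
    using P that unfolding linkage_def[OF assms(1,2)] G_def by auto
  show "\<exists>\<theta>. bij_betw \<theta> ?N (in_nbrs G Y - {X})
      \<and> disjoint_family_on (\<lambda>Z. set (shortest_path G Z (\<theta> Z))) ?N
      \<and> (\<forall>Z \<in> ?N. X \<notin> set (shortest_path G Z (\<theta> Z)) \<and> Y \<notin> set (shortest_path G Z (\<theta> Z)))"
  proof (intro exI[of _ "\<lambda>Z. last (P Z)"] conjI)
    show "bij_betw (\<lambda>Z. last (P Z)) ?N (in_nbrs G Y - {X})"
      using linkage_bij[OF assms(1,2)] XY P unfolding G_def by blast
    show "disjoint_family_on (\<lambda>Z. set (shortest_path G Z (last (P Z)))) ?N"
      using P sp unfolding linkage_def[OF assms(1,2)] G_def[symmetric] disjoint_family_on_def by auto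
  qed (use sp in auto)
qed

end
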